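(* Let $X$ be a separable symmetric sequence space of fundamental type and $1\le p\le\infty$. The following are equivalent: (i) $\ell^p$ is symmetrically block finitely represented in the unit vector basis $\{e_k\}$ of $X$; (ii) $\ell^p$ is symmetrically finitely represented in $X$; (iii) $\ell^p$ is crudely symmetrically finitely represented in $X$; (iv) $p\in[1/\beta_X,1/\alpha_X]$ (with $1/0=\infty$).
   Context: A Banach sequence lattice is a Banach space $E$ of real sequences such that $x\in E$, $|y_k|\le|x_k|$ imply $y\in E$, $\|y\|_E\le\|x\|_E$. $u^*$ is the nonincreasing rearrangement of $(|u_k|)$. A symmetric sequence space is a Banach sequence lattice $X\subset\ell^\infty$ with $x\in X$, $y^*=x^*$ implying $y\in X$, $\|y\|_X=\|x\|_X$. Boyd indices: $\alpha_X=-\lim_m\frac{\log_2\|\sigma_{1/m}\|_X}{\log_2m}$, $\beta_X=\lim_m\frac{\log_2\|\sigma_m\|_X}{\log_2m}$, where $\sigma_ma=(a_{[(m-1+n)/m]})_n$, $\sigma_{1/m}a=(\frac1m\sum_{k=(n-1)m+1}^{nm}a_k)_n$. With $\varphi_X(n)=\|\sum_{i=1}^ne_i\|_X$, $M^0_X(n)=\sup_m\varphi_X(m)/\varphi_X(mn)$, $M^\infty_X(n)=\sup_m\varphi_X(mn)/\varphi_X(m)$, $\mu_X=-\lim_n\frac{\log_2M^0_X(n)}{\log_2n}$, $\nu_X=\lim_n\frac{\log_2M^\infty_X(n)}{\log_2n}$; $X$ is of fundamental type if $\alpha_X=\mu_X$, $\beta_X=\nu_X$. Sequences $x,y$ have the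 same ordered distribution if $y_{\pi(k)}=x_k$ for some permutation $\pi$ of $\mathbb N$; finite blocks $\sum_{i=1}^m\alpha_ie_{n_i}$, $\sum_{i=1}^m\beta_ie_{k_i}$ (increasing indices) have the same ordered distribution if $\beta_i=\alpha_{\pi(i)}$ for a permutation $\pi$ of $\{1,\dots,m\}$. $\|a\|_p$ is the $\ell^p$ norm on $\mathbb R^n$ (max norm for $p=\infty$). $\ell^p$ is symmetrically block finitely represented in $\{e_k\}$ if for all $n,\varepsilon>0$ there are $0=m_0<\dots<m_n$ and reals $\alpha_i$ such that the blocks $u_k=\sum_{i=m_{k-1}+1}^{m_k}\alpha_ie_i$ pairwise have the same ordered distribution and $(1+\varepsilon)^{-1}\|a\|_p\le\|\sum a_ku_k\|_X\le(1+\varepsilon)\|a\|_p$ for all $a\in\mathbb R^n$. $\ell^p$ is symmetrically finitely represented in $X$ if for all $n,\varepsilon>0$ there are pairwise disjointly supported $x_1,\dots,x_n\in X$, pairwise with the same ordered distribution, satisfying the same two-sided $(1+\varepsilon)$ estimate; crudely symmetrically finitely represented if there is $C>0$ such that for every $n$ such $x_1,\dots,x_n$ exist with $C^{-1}\|a\|_p\le\|\sum a_kx_k\|_X\le C\|a\|_p$. *)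

theory Defs
  imports "HOL-Analysis.Analysis" "HOL-Library.Extended_Real"
begin

text \<open>Sequences are functions nat \<Rightarrow> real, indexed from 0 (so e_k is the indicator of {k},
  k = 0,1,2,...).  A sequence space is a pair (X, N) of a set of sequences and a norm
  function N on it.\<close>

definition unitvec :: "nat \<Rightarrow> nat \<Rightarrow> real" where
  "unitvec k = (\<lambda>i. if i = k then 1 else 0)"

definition banach_seq_lattice :: "(nat \<Rightarrow> real) set \<Rightarrow> ((nat \<Rightarrow> real) \<Rightarrow> real) \<Rightarrow> bool" where
  "banach_seq_lattice X N \<longleftrightarrow>
     (\<lambda>_. 0) \<in> X
   \<and> (\<forall>x\<in>X. \<forall>y\<in>X. (\<lambda>i. x i + y i) \<in> X)
   \<and> (\<forall>x\<in>X. \<forall>c::real. (\<lambda>i. c * x i) \<in> X)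
   \<and> (\<forall>x\<in>X. 0 \<le> N x \<and> (N x = 0 \<longleftrightarrow> x = (\<lambda>_. 0)))
   \<and> (\<forall>x\<in>X. \<forall>c::real. N (\<lambda>i. c * x i) = \<bar>c\<bar> * N x)
   \<and> (\<forall>x\<in>X. \<forall>y\<in>X. N (\<lambda>i. x i + y i) \<le> N x + N y)
   \<and> (\<forall>f::nat \<Rightarrow> nat \<Rightarrow> real. (\<forall>j. f j \<in> X) \<longrightarrow>
        (\<forall>\<epsilon>>0. \<exists>M. \<forall>a\<ge>M. \<forall>b\<ge>M. N (\<lambda>i. f a i - f b i) < \<epsilon>) \<longrightarrow>
        (\<exists>x\<in>X. (\<lambda>j. N (\<lambda>i. f j i - x i)) \<longlonglongrightarrow> 0))
   \<and> (\<forall>x\<in>X. \<forall>y. (\<forall>k. \<bar>y k\<bar> \<le> \<bar>x k\<bar>) \<longrightarrow> y \<in> X \<and> N y \<le> N x)"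

definition rearr :: "(nat \<Rightarrow> real) \<Rightarrow> nat \<Rightarrow> real" where
  "rearr u n = Inf {t. 0 \<le> t \<and> finite {k. \<bar>u k\<bar> > t} \<and> card {k. \<bar>u k\<bar> > t} \<le> n}"

definition bounded_seq :: "(nat \<Rightarrow> real) \<Rightarrow> bool" where
  "bounded_seq x \<longleftrightarrow> (\<exists>B. \<forall>k. \<bar>x k\<bar> \<le> B)"

definition symmetric_seq_space :: "(nat \<Rightarrow> real) set \<Rightarrow> ((nat \<Rightarrow> real) \<Rightarrow> real) \<Rightarrow> bool" where
  "symmetric_seq_space X N \<longleftrightarrow>
     banach_seq_lattice X N
   \<and> (\<forall>x\<in>X. bounded_seq x)
   \<and> (\<forall>x\<in>X. \<forall>y. bounded_seq y \<and> rearr y = rearr x \<longrightarrow> y \<in> X \<and> N y = N x)"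

definition separable_space :: "(nat \<Rightarrow> real) set \<Rightarrow> ((nat \<Rightarrow> real) \<Rightarrow> real) \<Rightarrow> bool" where
  "separable_space X N \<longleftrightarrow>
     (\<exists>D. countable D \<and> D \<subseteq> X \<and> (\<forall>x\<in>X. \<forall>\<epsilon>>0. \<exists>d\<in>D. N (\<lambda>i. x i - d i) < \<epsilon>))"

definition op_norm :: "(nat \<Rightarrow> real) set \<Rightarrow> ((nat \<Rightarrow> real) \<Rightarrow> real) \<Rightarrow> ((nat \<Rightarrow> real) \<Rightarrow> (nat \<Rightarrow> real)) \<Rightarrow> real" where
  "op_norm X N T = Sup {N (T x) | x. x \<in> X \<and> N x \<le> 1}"

definition sigma_up :: "nat \<Rightarrow> (nat \<Rightarrow> real) \<Rightarrow> nat \<Rightarrow> real" where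
  "sigma_up m a = (\<lambda>n. a (n div m))"

definition sigma_down :: "nat \<Rightarrow> (nat \<Rightarrow> real) \<Rightarrow> nat \<Rightarrow> real" where
  "sigma_down m a = (\<lambda>n. (1 / real m) * (\<Sum>k\<in>{n*m..<n*m+m}. a k))"

definition boyd_alpha :: "(nat \<Rightarrow> real) set \<Rightarrow> ((nat \<Rightarrow> real) \<Rightarrow> real) \<Rightarrow> real" where
  "boyd_alpha X N = - lim (\<lambda>m. log 2 (op_norm X N (sigma_down m)) / log 2 (real m))"

definition boyd_beta :: "(nat \<Rightarrow> real) set \<Rightarrow> ((nat \<Rightarrow> real) \<Rightarrow> real) \<Rightarrow> real" where
  "boyd_beta X N = lim (\<lambda>m. log 2 (op_norm X N (sigma_up m)) / log 2 (real m))"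

definition fund_fun :: "((nat \<Rightarrow> real) \<Rightarrow> real) \<Rightarrow> nat \<Rightarrow> real" where
  "fund_fun N n = N (\<lambda>i. if i < n then 1 else 0)"

definition M0 :: "((nat \<Rightarrow> real) \<Rightarrow> real) \<Rightarrow> nat \<Rightarrow> real" where
  "M0 N n = Sup {fund_fun N m / fund_fun N (m * n) | m. m \<ge> 1}"

definition Minf :: "((nat \<Rightarrow> real) \<Rightarrow> real) \<Rightarrow> nat \<Rightarrow> real" where
  "Minf N n = Sup {fund_fun N (m * n) / fund_fun N m | m. m \<ge> 1}"

definition fund_mu :: "((nat \<Rightarrow> real) \<Rightarrow> real) \<Rightarrow> real" where
  "fund_mu N = - lim (\<lambda>n. log 2 (M0 N n) / log 2 (real n))"

definition fund_nu :: "((nat \<Rightarrow> real) \<Rightarrow> real) \<Rightarrow> real" where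
  "fund_nu N = lim (\<lambda>n. log 2 (Minf N n) / log 2 (real n))"

definition fundamental_type :: "(nat \<Rightarrow> real) set \<Rightarrow> ((nat \<Rightarrow> real) \<Rightarrow> real) \<Rightarrow> bool" where
  "fundamental_type X N \<longleftrightarrow> boyd_alpha X N = fund_mu N \<and> boyd_beta X N = fund_nu N"

definition lp_norm :: "ereal \<Rightarrow> nat \<Rightarrow> (nat \<Rightarrow> real) \<Rightarrow> real" where
  "lp_norm p n a = (if p = \<infinity> then Max (insert 0 {\<bar>a k\<bar> | k. k < n})
                    else (\<Sum>k<n. \<bar>a k\<bar> powr real_of_ereal p) powr (1 / real_of_ereal p))"

definition lin_comb :: "nat \<Rightarrow> (nat \<Rightarrow> real) \<Rightarrow> (nat \<Rightarrow> nat \<Rightarrow> real) \<Rightarrow> nat \<Rightarrow> real" where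
  "lin_comb n a x = (\<lambda>i. \<Sum>k<n. a k * x k i)"

definition same_ord_dist :: "(nat \<Rightarrow> real) \<Rightarrow> (nat \<Rightarrow> real) \<Rightarrow> bool" where
  "same_ord_dist x y \<longleftrightarrow> (\<exists>\<pi>. bij \<pi> \<and> (\<forall>k. y (\<pi> k) = x k))"

definition block :: "(nat \<Rightarrow> nat) \<Rightarrow> (nat \<Rightarrow> real) \<Rightarrow> nat \<Rightarrow> nat \<Rightarrow> real" where
  "block m c k = (\<lambda>i. if m k \<le> i \<and> i < m (Suc k) then c i else 0)"

text \<open>Coefficient list of the k-th block; two finite blocks have the same ordered
  distribution iff their coefficient lists are permutations of each other.\<close>
definition block_coeffs :: "(nat \<Rightarrow> nat) \<Rightarrow> (nat \<Rightarrow> real) \<Rightarrow> nat \<Rightarrow> real list" where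
  "block_coeffs m c k = map c [m k..<m (Suc k)]"

definition sym_block_fin_rep :: "(nat \<Rightarrow> real) set \<Rightarrow> ((nat \<Rightarrow> real) \<Rightarrow> real) \<Rightarrow> ereal \<Rightarrow> bool" where
  "sym_block_fin_rep X N p \<longleftrightarrow>
    (\<forall>n\<ge>1. \<forall>\<epsilon>>0. \<exists>(m::nat \<Rightarrow> nat) (c::nat \<Rightarrow> real).
        m 0 = 0 \<and> (\<forall>k<n. m k < m (Suc k))
      \<and> (\<forall>j<n. \<forall>k<n. mset (block_coeffs m c j) = mset (block_coeffs m c k))
      \<and> (\<forall>a. lp_norm p n a / (1 + \<epsilon>) \<le> N (lin_comb n a (block m c))
             \<and> N (lin_comb n a (block m c)) \<le> (1 + \<epsilon>) * lp_norm p n a))"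

definition sym_fin_rep :: "(nat \<Rightarrow> real) set \<Rightarrow> ((nat \<Rightarrow> real) \<Rightarrow> real) \<Rightarrow> ereal \<Rightarrow> bool" where
  "sym_fin_rep X N p \<longleftrightarrow>
    (\<forall>n\<ge>1. \<forall>\<epsilon>>0. \<exists>x::nat \<Rightarrow> nat \<Rightarrow> real.
        (\<forall>k<n. x k \<in> X)
      \<and> (\<forall>j<n. \<forall>k<n. j \<noteq> k \<longrightarrow> (\<forall>i. x j i = 0 \<or> x k i = 0))
      \<and> (\<forall>j<n. \<forall>k<n. same_ord_dist (x j) (x k))
      \<and> (\<forall>a. lp_norm p n a / (1 + \<epsilon>) \<le> N (lin_comb n a x)
             \<and> N (lin_comb n a x) \<le> (1 + \<epsilon>) * lp_norm p n a))"

definition crude_sym_fin_rep :: "(nat \<Rightarrow> real) set \<Rightarrow> ((nat \<Rightarrow> real) \<Rightarrow> real) \<Rightarrow> ereal \<Rightarrow> bool" where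
  "crude_sym_fin_rep X N p \<longleftrightarrow>
    (\<exists>C>0. \<forall>n\<ge>1. \<exists>x::nat \<Rightarrow> nat \<Rightarrow> real.
        (\<forall>k<n. x k \<in> X)
      \<and> (\<forall>j<n. \<forall>k<n. j \<noteq> k \<longrightarrow> (\<forall>i. x j i = 0 \<or> x k i = 0))
      \<and> (\<forall>j<n. \<forall>k<n. same_ord_dist (x j) (x k))
      \<and> (\<forall>a. lp_norm p n a / C \<le> N (lin_comb n a x)
             \<and> N (lin_comb n a x) \<le> C * lp_norm p n a))"

definition einv :: "real \<Rightarrow> ereal" where
  "einv t = (if t = 0 then \<infinity> else ereal (1 / t))"

end

(* The fundamental function phi alone produces the blocks. If mu <= q = 1/p <= nu, then for every
   d > 0 the perturbed ratios phi(i) i^(d-q) and phi(i) i^(-q-d) have a common sharp peak: there are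
   A < k < B, arbitrarily far out, at which both are much larger at k than the first one is at A
   and the second one is at B. The sequence x(i) = (i/k)^(-q) min((i/k)^d, (k/i)^d), truncated at
   A and B, then satisfies sigma_r x = r^q x up to a factor close to 1 pointwise, apart from
   truncation errors of size phi(A) x(A) and phi(B) x(B), both negligible against phi(k) x(k), which
   is at most a constant times the norm of x. So x is a simultaneous approximate eigenvector of
   finitely many dilations. If a_k^p = r_k / M with r_k integers, disjoint copies of a_k x are close
   to M^(-q) sigma_{r_k} x and their sum is distributed like M^(-q) sigma_R x with R = sum r_k, hence
   has norm close to (R/M)^q = |a|_p; rounding handles the remaining a.
   Conversely, the sum of n disjoint copies of x_0 is distributed like sigma_n x_0, and
   sigma_{1/n} sigma_n x_0 = x_0, so a crude representation bounds the norms of sigma_n and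
   sigma_{1/n} from below by multiples of n^q and n^(-q). *)

theory Submission
  imports Defs "HOL-Combinatorics.List_Permutation" "HOL-Real_Asymp.Real_Asymp"
begin

text \<open>The exponent \<open>d\<close> is there because \<open>fund_fun\<close> alone has to beat
  the truncation errors. If \<open>fund_fun N i = i^q\<close>, then
  \<open>fund_fun N i * i^(-q)\<close> is constant, and for the pure power \<open>i^(-q)\<close> the
  ends are not visibly smaller than the middle. Bending the power by \<open>i^d\<close> on the left
  and \<open>i^(-d)\<close> on the right makes them smaller, while dilations up to \<open>R\<close>
  notice only a factor of about \<open>R^d\<close>. Hence \<open>d\<close> and the sharpness
  \<open>h\<close> of the peak are fixed by \<open>R\<close> and the tolerance before the peak is
  sought. The bounds by \<open>fund_mu\<close> and \<open>fund_nu\<close> give good ratios of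
  \<open>fund_fun\<close> at positions that cannot be prescribed. Multiplying a position by
  \<open>A0\<close> moves it far out and costs a factor \<open>A0\<close>, paid for by a surplus
  \<open>n^(d/2)\<close>. Far out is needed because \<open>i div r\<close> is only approximately
  \<open>i / r\<close>. Norms are identified through the sizes of level sets, so disjoint copies can
  be arranged at will: interleaved for computing, where equal summands give \<open>sigma_up\<close>
  literally, and consecutively for blocks.\<close>

text \<open>The indices are defined by \<open>lim\<close>, which is meaningless unless the limit exists. The last
  hypothesis replaces the monotonicity used in Fekete's lemma: it holds with \<open>C = f m\<close> for increasing
  \<open>f\<close>, with \<open>C = 1\<close> for decreasing \<open>f\<close>, and also for the norms of \<open>sigma_down\<close>, which need not be
  monotone.\<close>

lemma convergent_log_ratio:
  fixes f :: "nat \<Rightarrow> real"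
  assumes low: "\<And>n. n \<ge> 1 \<Longrightarrow> f n \<ge> 1 / real n"
    and one: "f 1 \<le> 1"
    and sub: "\<And>a b. a \<ge> 1 \<Longrightarrow> b \<ge> 1 \<Longrightarrow> f (a * b) \<le> f a * f b"
    and quasi: "\<And>m. m \<ge> 2 \<Longrightarrow> \<exists>C. \<forall>n j. m ^ j \<le> n \<and> n < m ^ Suc j \<longrightarrow> f n \<le> C * f (m ^ j)"
  shows "convergent (\<lambda>n. log 2 (f n) / log 2 (real n))"
proof -
  let ?g = "\<lambda>n. log 2 (f n) / log 2 (real n)"
  have pos: "f n > 0" if "n \<ge> 1" for n
  proof -
    have "0 < 1 / real n" using that by simp
    then show ?thesis using low[OF that] by linarith
  qed
  have power: "f (m ^ j) \<le> f m ^ j" if "m \<ge> 1" for m j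
  proof (induction j)
    case (Suc j)
    have "f (m ^ Suc j) \<le> f m * f (m ^ j)"
      using sub[of m "m ^ j"] that by simp
    also have "\<dots> \<le> f m * f m ^ j"
      using Suc pos[OF that] by (intro mult_left_mono) auto
    finally show ?case by simp
  qed (use one in simp)
  have ge: "?g n \<ge> -1" if "n \<ge> 2" for n
  proof -
    have "log 2 (1 / real n) \<le> log 2 (f n)"
      using low[of n] pos[of n] that by (subst log_le_cancel_iff) auto
    then have "- log 2 (real n) \<le> log 2 (f n)"
      using that by (simp add: log_divide)
    moreover have "log 2 (real n) > 0" using that by simp
    ultimately show ?thesis by (simp add: field_simps)
  qed
  define L where "L = Inf (?g ` {2..})"
  have bdd: "bdd_below (?g ` {2..})" using ge by (intro bdd_belowI[of _ "-1"]) auto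
  have Lle: "L \<le> ?g n" if "n \<ge> 2" for n
    unfolding L_def by (rule cInf_lower[OF _ bdd]) (use that in auto)
  have "?g \<longlonglongrightarrow> L"
  proof (rule LIMSEQ_I)
    fix e :: real assume e: "e > 0"
    have "\<exists>y\<in>?g ` {2..}. y < L + e / 2"
      using cInf_lessD[of "?g ` {2..}" "L + e / 2"] e unfolding L_def by auto
    then obtain m where m: "m \<ge> 2" "?g m < L + e / 2" by auto
    from quasi[OF m(1)] obtain C where C: "\<And>n j. m ^ j \<le> n \<Longrightarrow> n < m ^ Suc j \<Longrightarrow> f n \<le> C * f (m ^ j)"
      by blast
    define D where "D = max C 1"
    \<comment> \<open>\<open>K\<close> pays for the constant \<open>D\<close> and for replacing
      \<open>j\<close> by \<open>log 2 n / log 2 m\<close>, which is off by at most 1. The absolute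
      value is there because \<open>log 2 (f m)\<close> can have either sign.\<close>
    define K where "K = log 2 D + \<bar>log 2 (f m)\<bar>"
    have bound: "?g n \<le> ?g m + K / log 2 (real n)" if n: "n \<ge> 2" for n
    proof -
      obtain j where j: "m ^ j \<le> n" "n < m ^ (j + 1)"
        using ex_power_ivl1[of m n] m n by auto
      have lm: "log 2 (real m) > 0" "log 2 (real n) > 0" using m n by auto
      have "f n \<le> C * f (m ^ j)" using C j by simp
      also have "\<dots> \<le> D * f m ^ j"
        using power[of m j] pos[of "m ^ j"] m unfolding D_def by (intro mult_mono) auto
      finally have "log 2 (f n) \<le> log 2 (D * f m ^ j)"
        using pos[of n] n by (subst log_le_cancel_iff) (auto intro: less_le_trans)
      also have "\<dots> = log 2 D + real j * log 2 (f m)"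
        using pos[of m] m unfolding D_def by (subst log_mult) (auto simp: log_nat_power)
      finally have 1: "log 2 (f n) \<le> log 2 D + real j * log 2 (f m)" .
      have "real (m ^ j) \<le> real n" "real n \<le> real (m ^ (j + 1))" "real (m ^ j) > 0"
        using j m by (simp_all only: of_nat_le_iff less_imp_le) simp
      then have "log 2 (real (m ^ j)) \<le> log 2 (real n)" "log 2 (real n) \<le> log 2 (real (m ^ (j + 1)))"
        using n by (intro log_mono; linarith)+
      then have "real j * log 2 (real m) \<le> log 2 (real n)"
        "log 2 (real n) \<le> (real j + 1) * log 2 (real m)"
        using m by (simp_all only: of_nat_power log_nat_power of_nat_0_less_iff) (simp_all add: algebra_simps)
      then have "\<bar>real j - log 2 (real n) / log 2 (real m)\<bar> \<le> 1"
        using lm by (auto simp: field_simps abs_le_iff)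
      then have "\<bar>real j - log 2 (real n) / log 2 (real m)\<bar> * \<bar>log 2 (f m)\<bar> \<le> \<bar>log 2 (f m)\<bar>"
        by (intro mult_left_le_one_le) auto
      then have "(real j - log 2 (real n) / log 2 (real m)) * log 2 (f m) \<le> \<bar>log 2 (f m)\<bar>"
        by (metis abs_ge_self abs_mult order_trans)
      with 1 have "log 2 (f n) \<le> K + ?g m * log 2 (real n)"
        unfolding K_def by (simp add: field_simps)
      then show ?thesis using lm by (simp add: field_simps)
    qed
    have "(\<lambda>n. K / log 2 (real n)) \<longlonglongrightarrow> 0" by real_asymp
    then have "eventually (\<lambda>n. K / log 2 (real n) < e / 2) sequentially"
      by (rule order_tendstoD) (use e in auto)
    then have "eventually (\<lambda>n. norm (?g n - L) < e) sequentially"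
      using eventually_ge_at_top[of 2]
    proof eventually_elim
      case (elim n)
      then show ?case using bound[of n] Lle[of n] m(2) unfolding real_norm_def abs_less_iff by linarith
    qed
    then show "\<exists>no. \<forall>n\<ge>no. norm (?g n - L) < e" by (simp add: eventually_sequentially)
  qed
  then show ?thesis by (rule convergentI)
qed

section \<open>Disjoint sums, dilations and blocks of sequences\<close>

definition interleave :: "nat \<Rightarrow> (nat \<Rightarrow> nat \<Rightarrow> real) \<Rightarrow> nat \<Rightarrow> real" where
  "interleave n y = (\<lambda>i. y (i mod n) (i div n))"

text \<open>Division with remainder by \<open>n\<close> is the bijection. Sizes are compared by
  \<open>\<approx>\<close> because \<open>card\<close> is 0 on infinite sets and would confuse an
  infinite level set with an empty one.\<close>

lemma interleave_level_set:
  assumes "n \<ge> 1"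
  shows "{i. t < \<bar>interleave n y i\<bar>} \<approx> Sigma {..<n} (\<lambda>k. {j. t < \<bar>y k j\<bar>})"
proof -
  have "bij_betw (\<lambda>i. (i mod n, i div n)) {i. t < \<bar>interleave n y i\<bar>}
      (Sigma {..<n} (\<lambda>k. {j. t < \<bar>y k j\<bar>}))"
    by (rule bij_betwI[where g = "\<lambda>(k, j). j * n + k"])
      (use assms in \<open>auto simp: interleave_def\<close>)
  then show ?thesis unfolding eqpoll_def by blast
qed

lemma sigma_up_eq_interleave: "sigma_up n x = interleave n (\<lambda>_. x)"
  by (simp add: sigma_up_def interleave_def)

lemma sigma_up_level_set:
  assumes "n \<ge> 1"
  shows "{i. t < \<bar>sigma_up n x i\<bar>} \<approx> {..<n} \<times> {j. t < \<bar>x j\<bar>}"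
  using interleave_level_set[OF assms, of t "\<lambda>_. x"] by (simp add: sigma_up_eq_interleave)

lemma sigma_up_scale: "sigma_up n (\<lambda>i. c * x i) = (\<lambda>i. c * sigma_up n x i)"
  by (simp add: sigma_up_def)

lemma sigma_down_scale: "sigma_down n (\<lambda>i. c * x i) = (\<lambda>i. c * sigma_down n x i)"
  by (simp add: sigma_down_def sum_distrib_left mult.left_commute)

lemma sigma_up_indicator:
  assumes "n \<ge> 1"
  shows "sigma_up n (indicat_real {..<m}) = indicat_real {..<m * n}"
  using assms by (auto simp: sigma_up_def indicator_def fun_eq_iff div_less_iff_less_mult)

lemma sum_blocks:
  fixes g :: "nat \<Rightarrow> real"
  shows "sum g {q * M..<q * M + c * M} = (\<Sum>l<c. sum g {(q + l) * M..<(q + l) * M + M})"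
proof (induction c)
  case (Suc c)
  have "sum g {q * M..<q * M + Suc c * M}
      = sum g {q * M..<q * M + c * M} + sum g {q * M + c * M..<q * M + Suc c * M}"
    by (rule sum.atLeastLessThan_concat[symmetric]) auto
  then show ?case using Suc by (simp add: algebra_simps)
qed simp

lemma sigma_down_comp:
  assumes "a \<ge> 1" "b \<ge> 1"
  shows "sigma_down (a * b) x = sigma_down a (sigma_down b x)"
proof
  fix n
  have "sum x {n * (a * b)..<n * (a * b) + a * b}
      = (\<Sum>l<a. sum x {(n * a + l) * b..<(n * a + l) * b + b})"
    using sum_blocks[of x "n * a" b a] by (simp add: mult.assoc)
  moreover have "(\<Sum>k\<in>{n * a..<n * a + a}. g k) = (\<Sum>l<a. g (n * a + l))" for g :: "nat \<Rightarrow> real"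
    using sum.shift_bounds_nat_ivl[of g 0 "n * a" a]
    by (simp add: add.commute atLeast0LessThan)
  ultimately show "sigma_down (a * b) x n = sigma_down a (sigma_down b x) n"
    by (simp add: sigma_down_def sum_divide_distrib[symmetric])
qed

text \<open>Equal multisets only match the two index ranges, whereas a permutation of all indices is
  wanted. The complements of the ranges are both countably infinite and the blocks vanish there, so
  any bijection between the complements completes the matching.\<close>

lemma same_ord_dist_blocks:
  assumes "m k \<le> m (Suc k)" "m j \<le> m (Suc j)" and eq: "mset (block_coeffs m c j) = mset (block_coeffs m c k)"
  shows "same_ord_dist (block m c j) (block m c k)"
proof -
  let ?I = "\<lambda>k. {m k..<m (Suc k)}" and ?l = "\<lambda>k. m (Suc k) - m k"
  obtain f where f: "bij_betw f {..<?l j} {..<?l k}" "\<And>i. i < ?l j \<Longrightarrow> c (m j + i) = c (m k + f i)"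
  proof -
    obtain f where bij: "bij_betw f {..<?l j} {..<?l k}"
      and nth: "\<forall>i<?l j. block_coeffs m c j ! i = block_coeffs m c k ! f i"
      using permutation_Ex_bij[OF eq] by (auto simp: block_coeffs_def)
    have "f i < ?l k \<and> m k + f i < m (Suc k)" if "i < ?l j" for i
    proof -
      have "f i \<in> {..<?l k}" using bij_betwE[OF bij] that by blast
      then show ?thesis by simp
    qed
    then show ?thesis using bij nth by (intro that[of f]) (simp_all add: block_coeffs_def)
  qed
  let ?g = "\<lambda>i. m k + f (i - m j)"
  have "bij_betw (\<lambda>i. i - m j) (?I j) {..<?l j}"
    by (rule bij_betwI[where g = "\<lambda>i. i + m j"]) (use assms in auto)
  moreover have "bij_betw (\<lambda>i. m k + i) {..<?l k} (?I k)"
    by (rule bij_betwI[where g = "\<lambda>i. i - m k"]) (use assms in auto)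
  ultimately have g: "bij_betw ?g (?I j) (?I k)"
    using bij_betw_trans[OF bij_betw_trans[OF _ f(1)]] unfolding comp_def by blast
  have "infinite (- ?I j)" "infinite (- ?I k)" by (simp_all add: Compl_eq_Diff_UNIV)
  then have "bij_betw (to_nat_on (- ?I j)) (- ?I j) UNIV" "bij_betw (from_nat_into (- ?I k)) UNIV (- ?I k)"
    by (auto intro!: to_nat_on_infinite bij_betw_from_nat_into)
  from bij_betw_trans[OF this] obtain h where h: "bij_betw h (- ?I j) (- ?I k)" ..
  let ?\<pi> = "\<lambda>i. if i \<in> ?I j then ?g i else h i"
  have "bij_betw ?\<pi> (?I j \<union> - ?I j) (?I k \<union> - ?I k)"
    by (rule bij_betw_disjoint_Un[OF _ _ _ ]) (use g h in auto)
  then have "bij ?\<pi>" by simp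
  moreover have "block m c k (?\<pi> i) = block m c j i" for i
  proof (cases "i \<in> ?I j")
    case True
    then have "?g i \<in> ?I k" using g bij_betwE by blast
    then show ?thesis using True f(2)[of "i - m j"] by (auto simp: block_def)
  next
    case False
    then have "h i \<notin> ?I k" using h bij_betwE by blast
    then show ?thesis using False by (auto simp: block_def)
  qed
  ultimately show ?thesis unfolding same_ord_dist_def by blast
qed

text \<open>The case \<open>p = \<infinity>\<close> fits the formula because
  \<open>real_of_ereal \<infinity> = 0\<close> and \<open>1 / 0 = 0\<close> turn the right side into
  \<open>n powr 0 = 1\<close>.\<close>

lemma lp_norm_ones:
  assumes n: "n \<ge> 1"
  shows "lp_norm p n (\<lambda>_. 1) = real n powr (1 / real_of_ereal p)"
proof (cases "p = \<infinity>")
  case True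
  have "insert 0 {\<bar>1\<bar> |k. k < n} = {0, 1 :: real}" using n by (auto intro: exI[of _ 0])
  then show ?thesis using True n by (simp add: lp_norm_def)
qed (simp add: lp_norm_def)

lemma lp_norm_unitvec:
  assumes n: "n \<ge> 1"
  shows "lp_norm p n (unitvec 0) = 1"
proof (cases "p = \<infinity>")
  case True
  have "Max (insert 0 {\<bar>unitvec 0 k\<bar> |k. k < n}) = 1"
  proof (rule Max_eqI)
    have "\<bar>unitvec 0 0\<bar> = 1" by (simp add: unitvec_def)
    then show "1 \<in> insert 0 {\<bar>unitvec 0 k\<bar> |k. k < n}" using n by force
  qed (auto simp: unitvec_def)
  then show ?thesis using True by (simp add: lp_norm_def)
next
  case False
  have "(\<Sum>k<n. \<bar>unitvec 0 k\<bar> powr r) = (\<Sum>k<n. if k = 0 then 1 else 0)" for r :: real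
    by (intro sum.cong) (auto simp: unitvec_def)
  also have "\<dots> = (1 :: real)" using n by (simp add: sum.delta)
  finally show ?thesis using False by (simp add: lp_norm_def)
qed

section \<open>Symmetric sequence spaces\<close>

locale symmetric_space =
  fixes X :: "(nat \<Rightarrow> real) set" and N :: "(nat \<Rightarrow> real) \<Rightarrow> real"
  assumes symmetric: "symmetric_seq_space X N" and nontrivial: "X \<noteq> {\<lambda>_. 0}"
begin

lemma lattice: "banach_seq_lattice X N"
  using symmetric unfolding symmetric_seq_space_def by blast

lemma zero_mem: "(\<lambda>_. 0) \<in> X"
  using lattice unfolding banach_seq_lattice_def by blast

lemma add_mem: "x \<in> X \<Longrightarrow> y \<in> X \<Longrightarrow> (\<lambda>i. x i + y i) \<in> X"
  using lattice unfolding banach_seq_lattice_def by blast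

lemma scale_mem: "x \<in> X \<Longrightarrow> (\<lambda>i. c * x i) \<in> X"
  using lattice unfolding banach_seq_lattice_def by blast

lemma norm_nonneg: "x \<in> X \<Longrightarrow> 0 \<le> N x"
  using lattice unfolding banach_seq_lattice_def by blast

lemma norm_eq_0_iff: "x \<in> X \<Longrightarrow> N x = 0 \<longleftrightarrow> x = (\<lambda>_. 0)"
  using lattice unfolding banach_seq_lattice_def by blast

lemma norm_zero: "N (\<lambda>_. 0) = 0"
  using norm_eq_0_iff zero_mem by blast

lemma norm_scale: "x \<in> X \<Longrightarrow> N (\<lambda>i. c * x i) = \<bar>c\<bar> * N x"
  using lattice unfolding banach_seq_lattice_def by blast

lemma norm_add: "x \<in> X \<Longrightarrow> y \<in> X \<Longrightarrow> N (\<lambda>i. x i + y i) \<le> N x + N y"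
  using lattice unfolding banach_seq_lattice_def by blast

lemma dominated:
  assumes "x \<in> X" "\<And>k. \<bar>y k\<bar> \<le> \<bar>x k\<bar>"
  shows "y \<in> X" "N y \<le> N x"
  using lattice assms unfolding banach_seq_lattice_def by blast+

lemma sum_mem_norm:
  assumes "finite K" "\<And>k. k \<in> K \<Longrightarrow> f k \<in> X"
  shows "(\<lambda>i. \<Sum>k\<in>K. f k i) \<in> X \<and> N (\<lambda>i. \<Sum>k\<in>K. f k i) \<le> (\<Sum>k\<in>K. N (f k))"
  using assms
proof (induction K rule: finite_induct)
  case empty
  then show ?case by (simp add: zero_mem norm_zero)
next
  case (insert k K)
  then show ?case
    using add_mem[of "f k" "\<lambda>i. \<Sum>k\<in>K. f k i"] norm_add[of "f k" "\<lambda>i. \<Sum>k\<in>K. f k i"]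
    by auto
qed

lemma diff_mem: "x \<in> X \<Longrightarrow> y \<in> X \<Longrightarrow> (\<lambda>i. x i - y i) \<in> X"
  using add_mem[of x "\<lambda>i. -1 * y i"] scale_mem[of y "-1"] by simp

lemma norm_le_add_diff:
  assumes "x \<in> X" "y \<in> X"
  shows "N x \<le> N y + N (\<lambda>i. x i - y i)"
  using norm_add[of y "\<lambda>i. x i - y i"] diff_mem assms by simp

lemma norm_diff_commute:
  assumes "x \<in> X" "y \<in> X"
  shows "N (\<lambda>i. x i - y i) = N (\<lambda>i. y i - x i)"
  using norm_scale[of "\<lambda>i. x i - y i" "-1"] diff_mem assms by simp

text \<open>\<open>rearr\<close> sees a sequence only through the finiteness and size of its level
  sets at \<open>t \<ge> 0\<close>. The symmetry axiom also asks for \<open>bounded_seq y\<close>,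
  since for unbounded sequences the \<open>Inf\<close> in \<open>rearr\<close> is taken over the
  empty set; boundedness is transferred by the level set of \<open>x\<close> at its bound, which is
  empty.\<close>

lemma equidistributed:
  assumes x: "x \<in> X" and eq: "\<And>t. t \<ge> 0 \<Longrightarrow> {i. t < \<bar>x i\<bar>} \<approx> {i. t < \<bar>y i\<bar>}"
  shows "y \<in> X" "N y = N x"
proof -
  have fin: "finite {i. t < \<bar>x i\<bar>} = finite {i. t < \<bar>y i\<bar>}"
    and card: "card {i. t < \<bar>x i\<bar>} = card {i. t < \<bar>y i\<bar>}" if "t \<ge> 0" for t
    using eq[OF that] eqpoll_finite_iff bij_betw_same_card unfolding eqpoll_def by blast+
  obtain B where B: "\<And>k. \<bar>x k\<bar> \<le> B"
    using symmetric x unfolding symmetric_seq_space_def bounded_seq_def by blast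
  then have B0: "B \<ge> 0" using abs_ge_zero order_trans by blast
  have "{i. B < \<bar>x i\<bar>} = {}" using B by (auto simp: not_less)
  with eqpoll_sym[OF eq[OF B0]] have "{i. B < \<bar>y i\<bar>} = {}" by simp
  then have "bounded_seq y" unfolding bounded_seq_def by (metis (mono_tags) empty_Collect_eq not_less)
  moreover have "rearr y n = rearr x n" for n
    unfolding rearr_def by (rule arg_cong[where f = Inf]) (use fin card in auto)
  then have "rearr y = rearr x" by blast
  ultimately show "y \<in> X" "N y = N x"
    using symmetric x unfolding symmetric_seq_space_def by blast+
qed

text \<open>Up to zeros, the new sequence is a rearrangement of the restriction of \<open>x\<close>
  to \<open>range \<pi>\<close>, and restricting does not increase a lattice norm. All passages to
  subsequences rest on this.\<close>

lemma reindexed: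
  assumes "x \<in> X" "inj \<pi>"
  shows "(\<lambda>i. x (\<pi> i)) \<in> X" "N (\<lambda>i. x (\<pi> i)) \<le> N x"
proof -
  let ?y = "\<lambda>j. if j \<in> range \<pi> then x j else 0"
  have y: "?y \<in> X" "N ?y \<le> N x" using dominated[OF assms(1), of ?y] by auto
  have "{i. t < \<bar>?y i\<bar>} \<approx> {i. t < \<bar>x (\<pi> i)\<bar>}" if "t \<ge> 0" for t
  proof -
    have "{i. t < \<bar>?y i\<bar>} = \<pi> ` {i. t < \<bar>x (\<pi> i)\<bar>}" using that by auto
    then show ?thesis
      using inj_on_image_eqpoll_self[OF inj_on_subset[OF assms(2) subset_UNIV]] by metis
  qed
  from equidistributed[OF y(1) this] y(2)
  show "(\<lambda>i. x (\<pi> i)) \<in> X" "N (\<lambda>i. x (\<pi> i)) \<le> N x" by auto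
qed

lemma interleave_mem_norm:
  assumes n: "n \<ge> 1" and y: "\<And>k. k < n \<Longrightarrow> y k \<in> X"
  shows "interleave n y \<in> X" "N (interleave n y) \<le> (\<Sum>k<n. N (y k))"
proof -
  let ?f = "\<lambda>k i. if i mod n = k then y k (i div n) else 0"
  have f: "?f k \<in> X \<and> N (?f k) = N (y k)" if k: "k < n" for k
  proof -
    have "{j. t < \<bar>y k j\<bar>} \<approx> {i. t < \<bar>?f k i\<bar>}" if "t \<ge> 0" for t
    proof -
      have "{i. t < \<bar>?f k i\<bar>} = (\<lambda>j. j * n + k) ` {j. t < \<bar>y k j\<bar>}"
      proof (intro set_eqI iffI)
        fix i assume "i \<in> {i. t < \<bar>?f k i\<bar>}"
        then have "i mod n = k" "t < \<bar>y k (i div n)\<bar>" using that by (auto split: if_splits)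
        then show "i \<in> (\<lambda>j. j * n + k) ` {j. t < \<bar>y k j\<bar>}"
          by (intro image_eqI[of _ _ "i div n"]) auto
      qed (use k in auto)
      moreover have "inj_on (\<lambda>j. j * n + k) {j. t < \<bar>y k j\<bar>}" using n by (auto simp: inj_on_def)
      ultimately show ?thesis using inj_on_image_eqpoll_self eqpoll_sym by metis
    qed
    then show ?thesis using equidistributed[OF y[OF k], of "?f k"] by simp
  qed
  have "interleave n y = (\<lambda>i. \<Sum>k<n. ?f k i)"
    using n by (simp add: interleave_def fun_eq_iff)
  then show "interleave n y \<in> X" "N (interleave n y) \<le> (\<Sum>k<n. N (y k))"
    using sum_mem_norm[of "{..<n}" ?f] f by simp_all
qed

lemma sigma_up_mem: "x \<in> X \<Longrightarrow> n \<ge> 1 \<Longrightarrow> sigma_up n x \<in> X"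
  and norm_sigma_up_le: "x \<in> X \<Longrightarrow> n \<ge> 1 \<Longrightarrow> N (sigma_up n x) \<le> real n * N x"
  using interleave_mem_norm[of n "\<lambda>_. x"] by (simp_all add: sigma_up_eq_interleave)

text \<open>Averaging over blocks of length \<open>n\<close> is the average of the \<open>n\<close>
  subsequences along the residue classes mod \<open>n\<close>, each of norm at most
  \<open>N x\<close> by \<open>reindexed\<close>.\<close>

lemma sigma_down_mem: "x \<in> X \<Longrightarrow> n \<ge> 1 \<Longrightarrow> sigma_down n x \<in> X"
  and norm_sigma_down_le: "x \<in> X \<Longrightarrow> n \<ge> 1 \<Longrightarrow> N (sigma_down n x) \<le> N x"
proof -
  assume x: "x \<in> X" and n: "n \<ge> 1"
  have "inj (\<lambda>i. i * n + l)" for l using n by (auto simp: inj_on_def)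
  then have r: "(\<lambda>i. x (i * n + l)) \<in> X" "N (\<lambda>i. x (i * n + l)) \<le> N x" for l
    using reindexed[OF x] by auto
  have eq: "sigma_down n x = (\<lambda>i. 1 / real n * (\<Sum>l<n. x (i * n + l)))"
    unfolding sigma_down_def
    by (simp add: sum.shift_bounds_nat_ivl[of x 0 _ n, simplified] add.commute
        atLeast0LessThan[symmetric] sum.atLeastLessThan_shift_0[of x "_ * n"])
  have s: "(\<lambda>i. \<Sum>l<n. x (i * n + l)) \<in> X"
    "N (\<lambda>i. \<Sum>l<n. x (i * n + l)) \<le> (\<Sum>l<n. N (\<lambda>i. x (i * n + l)))"
    using sum_mem_norm[of "{..<n}" "\<lambda>l i. x (i * n + l)"] r by auto
  note s(2)
  also have "(\<Sum>l<n. N (\<lambda>i. x (i * n + l))) \<le> (\<Sum>l<n. N x)" by (intro sum_mono r)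
  finally have "N (\<lambda>i. \<Sum>l<n. x (i * n + l)) \<le> real n * N x" by simp
  then show "N (sigma_down n x) \<le> N x"
    unfolding eq using n s(1) by (subst norm_scale) (auto simp: field_simps)
  show "sigma_down n x \<in> X" unfolding eq by (rule scale_mem[OF s(1)])
qed

section \<open>Dilation norms and the existence of the indices\<close>

lemma op_norm_le:
  assumes "\<And>x. x \<in> X \<Longrightarrow> N (T x) \<le> K * N x" "K \<ge> 0"
  shows "op_norm X N T \<le> K"
  unfolding op_norm_def
proof (rule cSup_least)
  show "{N (T x) |x. x \<in> X \<and> N x \<le> 1} \<noteq> {}"
    using zero_mem norm_zero by (auto intro!: exI[of _ "\<lambda>_. 0"])
  fix r assume "r \<in> {N (T x) |x. x \<in> X \<and> N x \<le> 1}"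
  then obtain x where x: "x \<in> X" "N x \<le> 1" "r = N (T x)" by auto
  have "K * N x \<le> K * 1" using x assms(2) by (intro mult_left_mono)
  then show "r \<le> K" using assms(1)[of x] x by simp
qed

text \<open>The constant \<open>K\<close> may be any a priori bound: it guarantees that the
  \<open>Sup\<close> in \<open>op_norm\<close> is taken over a bounded set and is therefore a true
  supremum. Homogeneity then allows normalising \<open>x\<close>.\<close>

lemma le_op_norm:
  assumes x: "x \<in> X" and mem: "\<And>x. x \<in> X \<Longrightarrow> T x \<in> X"
    and bound: "\<And>x. x \<in> X \<Longrightarrow> N (T x) \<le> K * N x"
    and hom: "\<And>c x. T (\<lambda>i. c * x i) = (\<lambda>i. c * T x i)"
  shows "N (T x) \<le> op_norm X N T * N x"
proof (cases "N x = 0")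
  case True
  then show ?thesis using bound[OF x] by simp
next
  case False
  then have pos: "N x > 0" using norm_nonneg[OF x] by simp
  let ?S = "{N (T x) |x. x \<in> X \<and> N x \<le> 1}"
  have "bdd_above ?S"
  proof (rule bdd_aboveI)
    fix r assume "r \<in> ?S"
    then obtain x where x: "x \<in> X" "N x \<le> 1" "r = N (T x)" by auto
    have "K * N x \<le> \<bar>K\<bar> * 1" using x norm_nonneg[OF x(1)] by (intro mult_mono) auto
    then show "r \<le> \<bar>K\<bar>" using bound[OF x(1)] x by simp
  qed
  moreover have "N (T (\<lambda>i. 1 / N x * x i)) \<in> ?S"
    using scale_mem[OF x, of "1 / N x"] norm_scale[OF x, of "1 / N x"] pos
    by (intro CollectI exI[of _ "\<lambda>i. 1 / N x * x i"]) simp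
  ultimately have "N (T (\<lambda>i. 1 / N x * x i)) \<le> op_norm X N T"
    unfolding op_norm_def by (rule cSup_upper[rotated])
  then show ?thesis
    unfolding hom norm_scale[OF mem[OF x]] using pos by (simp add: field_simps)
qed

lemma sigma_up_op_norm:
  assumes "x \<in> X" "n \<ge> 1"
  shows "N (sigma_up n x) \<le> op_norm X N (sigma_up n) * N x"
  by (rule le_op_norm[OF assms(1), where K = "real n"])
    (use assms in \<open>auto simp: sigma_up_mem norm_sigma_up_le sigma_up_scale\<close>)

lemma sigma_down_op_norm:
  assumes "x \<in> X" "n \<ge> 1"
  shows "N (sigma_down n x) \<le> op_norm X N (sigma_down n) * N x"
  by (rule le_op_norm[OF assms(1), where K = 1])
    (use assms in \<open>auto simp: sigma_down_mem norm_sigma_down_le sigma_down_scale\<close>)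

text \<open>A nonzero element has a nonzero coordinate \<open>k\<close>; domination isolates it,
  symmetry moves it to any other place, and finite sums give the rest.\<close>

lemma indicator_mem:
  assumes "finite A"
  shows "indicat_real A \<in> X"
proof -
  obtain x k where x: "x \<in> X" "x k \<noteq> 0" using nontrivial zero_mem by fastforce
  have k: "indicat_real {k} \<in> X"
    by (rule dominated[OF scale_mem[OF x(1), of "1 / x k"]]) (use x in \<open>auto simp: indicator_def\<close>)
  have "indicat_real {j} \<in> X" for j
  proof (rule equidistributed[OF k])
    fix t :: real assume "t \<ge> 0"
    have "{i. t < \<bar>indicat_real {j} i\<bar>} = (if t < 1 then {j} else {})" for j :: nat
      using \<open>t \<ge> 0\<close> by (auto simp: indicator_def)
    then show "{i. t < \<bar>indicat_real {k} i\<bar>} \<approx> {i. t < \<bar>indicat_real {j} i\<bar>}"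
      by (simp add: singleton_eqpoll)
  qed
  then have "(\<lambda>i. \<Sum>j\<in>A. indicat_real {j} i) \<in> X" using sum_mem_norm[OF assms, of "\<lambda>j. indicat_real {j}"] by simp
  moreover have "(\<lambda>i. \<Sum>j\<in>A. indicat_real {j} i) = indicat_real A"
    using assms by (auto simp: fun_eq_iff indicator_def)
  ultimately show ?thesis by simp
qed

lemma fund_fun_eq: "fund_fun N n = N (indicat_real {..<n})"
  unfolding fund_fun_def by (rule arg_cong[where f = N]) (auto simp: indicator_def)

lemma norm_indicator:
  assumes "finite A"
  shows "N (indicat_real A) = fund_fun N (card A)"
  unfolding fund_fun_eq
proof (rule equidistributed[OF indicator_mem])
  fix t :: real assume "t \<ge> 0"
  then have "{i. t < \<bar>indicat_real B i\<bar>} = (if t < 1 then B else {})" for B :: "nat set"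
    by (auto simp: indicator_def)
  then show "{i. t < \<bar>indicat_real {..<card A} i\<bar>} \<approx> {i. t < \<bar>indicat_real A i\<bar>}"
    using assms by (simp add: eqpoll_iff_card)
qed simp

lemma finite_support_mem:
  assumes "\<And>i. i \<ge> L \<Longrightarrow> x i = 0"
  shows "x \<in> X"
proof (rule dominated[OF scale_mem[OF indicator_mem[of "{..<L}"]]])
  fix i
  have "\<bar>x i\<bar> \<le> (\<Sum>k<L. \<bar>x k\<bar>)" if "i < L" using that by (intro member_le_sum) auto
  then show "\<bar>x i\<bar> \<le> \<bar>(\<Sum>k<L. \<bar>x k\<bar>) * indicat_real {..<L} i\<bar>"
    using assms[of i] by (cases "i < L") (auto simp: indicator_def)
qed simp

lemma fund_fun_mono: "m \<le> n \<Longrightarrow> fund_fun N m \<le> fund_fun N n"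
  unfolding fund_fun_eq by (rule dominated[OF indicator_mem]) (auto simp: indicator_def)

lemma fund_fun_pos:
  assumes "n \<ge> 1"
  shows "fund_fun N n > 0"
proof -
  have "indicat_real {..<n} 0 \<noteq> 0" using assms by (auto simp: indicator_def)
  then have "N (indicat_real {..<n}) \<noteq> 0"
    using norm_eq_0_iff[OF indicator_mem[of "{..<n}"]] by (metis finite_lessThan)
  then show ?thesis
    unfolding fund_fun_eq using norm_nonneg[OF indicator_mem[of "{..<n}"]] by simp
qed

text \<open>Dilation maps initial indicators exactly to initial indicators, so this is the triangle
  inequality for \<open>n\<close> disjoint copies.\<close>

lemma fund_fun_mult_le:
  assumes "n \<ge> 1"
  shows "fund_fun N (m * n) \<le> real n * fund_fun N m"
  using norm_sigma_up_le[OF indicator_mem assms, of "{..<m}"] sigma_up_indicator[OF assms]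
  by (simp add: fund_fun_eq)

text \<open>A window of length \<open>n\<close> is covered by \<open>m + 1\<close> consecutive blocks of length \<open>M\<close>, and \<open>M \<le> n\<close> makes
  the index of the first of these blocks an injective function of the window.\<close>

lemma sigma_down_quasi_monotone:
  assumes M: "M \<ge> 1" "M \<le> n" "n \<le> m * M"
  shows "op_norm X N (sigma_down n) \<le> real (m + 1) * op_norm X N (sigma_down M)"
proof (rule op_norm_le)
  have zero: "0 \<le> op_norm X N (sigma_down M)"
  proof -
    have "0 \<le> N (sigma_down M (indicat_real {0}))"
      using M by (intro norm_nonneg sigma_down_mem indicator_mem) auto
    also have "\<dots> \<le> op_norm X N (sigma_down M) * N (indicat_real {0})"
      using M by (intro sigma_down_op_norm indicator_mem) auto
    finally show ?thesis
      using fund_fun_pos[of 1] norm_indicator[of "{0}"] by (simp add: zero_le_mult_iff)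
  qed
  then show "0 \<le> real (m + 1) * op_norm X N (sigma_down M)" by simp
  fix x assume x: "x \<in> X"
  \<comment> \<open>Passing to absolute values makes all block averages nonnegative, so that a
    window may be enlarged to the union of the blocks covering it.\<close>
  let ?x = "\<lambda>i. \<bar>x i\<bar>"
  have ax: "?x \<in> X" "N ?x \<le> N x" using dominated[OF x, of ?x] by auto
  define b where "b = sigma_down M ?x"
  have b: "b \<in> X" "N b \<le> op_norm X N (sigma_down M) * N x"
  proof -
    show "b \<in> X" unfolding b_def using sigma_down_mem ax M by blast
    have "N b \<le> op_norm X N (sigma_down M) * N ?x"
      unfolding b_def using sigma_down_op_norm ax M by blast
    also have "\<dots> \<le> op_norm X N (sigma_down M) * N x" using ax zero by (intro mult_left_mono)
    finally show "N b \<le> op_norm X N (sigma_down M) * N x" .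
  qed
  have b0: "b i \<ge> 0" for i unfolding b_def sigma_down_def by (auto intro!: sum_nonneg)
  have "inj (\<lambda>i. i * n div M + l)" for l
  proof -
    have "i * n div M < Suc i * n div M" for i
    proof -
      have "Suc (i * n div M) = (i * n + M) div M" using M by simp
      also have "\<dots> \<le> Suc i * n div M" using M by (intro div_le_mono) auto
      finally show ?thesis by simp
    qed
    then have "strict_mono (\<lambda>i. i * n div M + l)" by (simp add: strict_mono_Suc_iff)
    then show ?thesis by (rule strict_mono_imp_inj_on)
  qed
  then have r: "(\<lambda>i. b (i * n div M + l)) \<in> X" "N (\<lambda>i. b (i * n div M + l)) \<le> N b" for l
    using reindexed[OF b(1)] by auto
  have s: "(\<lambda>i. \<Sum>l<m + 1. b (i * n div M + l)) \<in> X"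
    "N (\<lambda>i. \<Sum>l<m + 1. b (i * n div M + l)) \<le> (\<Sum>l<m + 1. N (\<lambda>i. b (i * n div M + l)))"
    using sum_mem_norm[of "{..<m + 1}" "\<lambda>l i. b (i * n div M + l)"] r by auto
  have "\<bar>sigma_down n x i\<bar> \<le> \<bar>\<Sum>l<m + 1. b (i * n div M + l)\<bar>" for i
  proof -
    define q where "q = i * n div M"
    have q: "q * M \<le> i * n" "i * n < q * M + M"
      using M dividend_less_div_times[of M "i * n"] unfolding q_def
      by (auto simp: div_times_less_eq_dividend add.commute)
    have "\<bar>sigma_down n x i\<bar> = 1 / real n * \<bar>\<Sum>k\<in>{i * n..<i * n + n}. x k\<bar>"
      by (simp add: sigma_down_def abs_mult)
    also have "\<dots> \<le> 1 / real n * (\<Sum>k\<in>{i * n..<i * n + n}. \<bar>x k\<bar>)"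
      by (intro mult_left_mono sum_abs) auto
    also have "\<dots> \<le> 1 / real M * (\<Sum>k\<in>{q * M..<q * M + (m + 1) * M}. \<bar>x k\<bar>)"
      using M q by (intro mult_mono sum_mono2 frac_le) (auto intro!: sum_nonneg)
    also have "\<dots> = (\<Sum>l<m + 1. b (q + l))"
      unfolding sum_blocks b_def sigma_down_def by (simp only: sum_distrib_left)
    finally show ?thesis unfolding q_def by simp
  qed
  then have "N (sigma_down n x) \<le> N (\<lambda>i. \<Sum>l<m + 1. b (i * n div M + l))"
    by (rule dominated[OF s(1)])
  also have "\<dots> \<le> (\<Sum>l<m + 1. N b)" using s(2) sum_mono[OF r(2)] by (rule order_trans)
  also have "\<dots> = real (m + 1) * N b" by simp
  also have "\<dots> \<le> real (m + 1) * (op_norm X N (sigma_down M) * N x)"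
    using b by (intro mult_left_mono) auto
  finally show "N (sigma_down n x) \<le> real (m + 1) * op_norm X N (sigma_down M) * N x"
    by (simp add: mult.assoc)
qed

lemma boyd_beta_limit:
  "(\<lambda>m. log 2 (op_norm X N (sigma_up m)) / log 2 (real m)) \<longlonglongrightarrow> boyd_beta X N"
  and op_norm_sigma_up_ge_1: "n \<ge> 1 \<Longrightarrow> op_norm X N (sigma_up n) \<ge> 1"
proof -
  let ?f = "\<lambda>n. op_norm X N (sigma_up n)"
  show ge1: "?f n \<ge> 1" if n: "n \<ge> 1" for n
  proof -
    have "fund_fun N 1 \<le> fund_fun N (1 * n)" using n by (intro fund_fun_mono) simp
    also have "\<dots> \<le> ?f n * fund_fun N 1"
      using sigma_up_op_norm[OF indicator_mem n, of "{..<1}"] sigma_up_indicator[OF n, of 1]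
      by (simp add: fund_fun_eq)
    finally show ?thesis using fund_fun_pos[of 1] by simp
  qed
  have sub: "?f (a * b) \<le> ?f a * ?f b" if "a \<ge> 1" "b \<ge> 1" for a b
  proof (rule op_norm_le)
    fix x assume x: "x \<in> X"
    have "sigma_up (a * b) x = sigma_up a (sigma_up b x)"
      by (simp add: sigma_up_def div_mult2_eq)
    then have "N (sigma_up (a * b) x) \<le> ?f a * N (sigma_up b x)"
      using sigma_up_op_norm[OF sigma_up_mem[OF x that(2)] that(1)] by simp
    also have "\<dots> \<le> ?f a * (?f b * N x)"
      using ge1[OF that(1)] by (intro mult_left_mono sigma_up_op_norm x that) auto
    finally show "N (sigma_up (a * b) x) \<le> ?f a * ?f b * N x" by (simp add: mult.assoc)
  next
    show "0 \<le> ?f a * ?f b" using ge1[OF that(1)] ge1[OF that(2)] by simp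
  qed
  have mono: "?f n \<le> ?f n'" if n: "n \<ge> 1" "n \<le> n'" for n n'
  proof (rule op_norm_le)
    fix x assume x: "x \<in> X"
    \<comment> \<open>Keeping the block number and the remainder embeds each block of length
      \<open>n\<close> into the corresponding block of length \<open>n'\<close>. Thus
      \<open>sigma_up n x\<close> is a subsequence of \<open>sigma_up n' x\<close>.\<close>
    let ?\<pi> = "\<lambda>i. i div n * n' + i mod n"
    have less: "i mod n < n'" for i using n by (metis less_le_trans mod_less_divisor not_less_eq_eq One_nat_def zero_less_Suc neq0_conv)
    have "?\<pi> i div n' = i div n" "?\<pi> i mod n' = i mod n" for i using less[of i] n by auto
    then have "inj ?\<pi>" by (metis (mono_tags, lifting) injI div_mult_mod_eq)
    moreover have "sigma_up n x = (\<lambda>i. sigma_up n' x (?\<pi> i))"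
      using less n by (auto simp: sigma_up_def)
    ultimately have "N (sigma_up n x) \<le> N (sigma_up n' x)"
      using reindexed(2)[OF sigma_up_mem[OF x, of n']] n by auto
    also have "\<dots> \<le> ?f n' * N x" using n by (intro sigma_up_op_norm x) auto
    finally show "N (sigma_up n x) \<le> ?f n' * N x" .
  qed (use ge1[of n'] n in auto)
  have "convergent (\<lambda>m. log 2 (?f m) / log 2 (real m))"
  proof (rule convergent_log_ratio[OF _ _ sub])
    show "1 / real n \<le> ?f n" if "n \<ge> 1" for n
      using ge1[OF that] that by (auto intro: order_trans[of _ 1])
    show "?f 1 \<le> 1" by (rule op_norm_le) (auto simp: sigma_up_def)
    fix m :: nat assume m: "m \<ge> 2"
    show "\<exists>C. \<forall>n j. m ^ j \<le> n \<and> n < m ^ Suc j \<longrightarrow> ?f n \<le> C * ?f (m ^ j)"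
    proof (intro exI allI impI)
      fix n j assume "m ^ j \<le> n \<and> n < m ^ Suc j"
      moreover from this have "1 \<le> n" using m by (metis le_trans one_le_power one_le_numeral)
      ultimately show "?f n \<le> ?f m * ?f (m ^ j)"
        using mono[of n "m * m ^ j"] sub[of m "m ^ j"] m by simp
    qed
  qed
  then show "(\<lambda>m. log 2 (?f m) / log 2 (real m)) \<longlonglongrightarrow> boyd_beta X N"
    unfolding boyd_beta_def by (simp add: convergent_LIMSEQ_iff)
qed

lemma boyd_alpha_limit:
  "(\<lambda>m. log 2 (op_norm X N (sigma_down m)) / log 2 (real m)) \<longlonglongrightarrow> - boyd_alpha X N"
  and op_norm_sigma_down_ge: "n \<ge> 1 \<Longrightarrow> op_norm X N (sigma_down n) \<ge> 1 / real n"
proof -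
  let ?f = "\<lambda>n. op_norm X N (sigma_down n)"
  show ge: "?f n \<ge> 1 / real n" if n: "n \<ge> 1" for n
  proof -
    \<comment> \<open>The test vector for the lower bound: averaging \<open>n\<close> ones leaves a
      single one, so \<open>?f n\<close> is at least \<open>fund_fun N 1 / fund_fun N n\<close>,
      hence at least \<open>1 / n\<close>.\<close>
    have "sigma_down n (indicat_real {..<n}) i = indicat_real {..<1} i" for i
    proof (cases "i = 0")
      case False
      then have "indicat_real {..<n} k = 0" if "k \<ge> i * n" for k
        using that by (auto simp: indicator_def dest: le_less_trans)
      then have "(\<Sum>k\<in>{i * n..<i * n + n}. indicat_real {..<n} k) = 0" by (intro sum.neutral) auto
      then show ?thesis using False by (simp add: sigma_down_def)
    qed (use n in \<open>simp add: sigma_down_def\<close>)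
    then have "sigma_down n (indicat_real {..<n}) = indicat_real {..<1}" by blast
    then have "N (indicat_real {..<1}) \<le> ?f n * N (indicat_real {..<n})"
      using sigma_down_op_norm[OF indicator_mem n, of "{..<n}"] by simp
    then have 1: "fund_fun N 1 \<le> ?f n * fund_fun N n" by (simp add: fund_fun_eq)
    with fund_fun_pos[of 1] fund_fun_pos[OF n] have "?f n > 0"
      by (metis less_le_trans order_refl zero_less_mult_pos2)
    then have "?f n * fund_fun N n \<le> ?f n * (real n * fund_fun N 1)"
      using fund_fun_mult_le[OF n, of 1] by (intro mult_left_mono) auto
    with 1 have "fund_fun N 1 \<le> ?f n * real n * fund_fun N 1" by simp
    then show ?thesis using fund_fun_pos[of 1] n by (simp add: field_simps)
  qed
  have pos: "?f n \<ge> 0" if "n \<ge> 1" for n using ge[OF that] by (auto intro: order_trans[rotated])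
  have "convergent (\<lambda>m. log 2 (?f m) / log 2 (real m))"
  proof (rule convergent_log_ratio)
    show "1 / real n \<le> ?f n" if "n \<ge> 1" for n using ge[OF that] .
    show "?f 1 \<le> 1" by (rule op_norm_le) (auto simp: sigma_down_def)
    show "?f (a * b) \<le> ?f a * ?f b" if "a \<ge> 1" "b \<ge> 1" for a b
    proof (rule op_norm_le)
      fix x assume x: "x \<in> X"
      have "N (sigma_down (a * b) x) \<le> ?f a * N (sigma_down b x)"
        unfolding sigma_down_comp[OF that] by (intro sigma_down_op_norm sigma_down_mem x that)
      also have "\<dots> \<le> ?f a * (?f b * N x)"
        using pos[OF that(1)] by (intro mult_left_mono sigma_down_op_norm x that) auto
      finally show "N (sigma_down (a * b) x) \<le> ?f a * ?f b * N x" by (simp add: mult.assoc)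
    qed (use pos that in auto)
    fix m :: nat assume m: "m \<ge> 2"
    then show "\<exists>C. \<forall>n j. m ^ j \<le> n \<and> n < m ^ Suc j \<longrightarrow> ?f n \<le> C * ?f (m ^ j)"
      by (intro exI[of _ "real (m + 1)"] allI impI sigma_down_quasi_monotone) auto
  qed
  then show "(\<lambda>m. log 2 (?f m) / log 2 (real m)) \<longlonglongrightarrow> - boyd_alpha X N"
    unfolding boyd_alpha_def by (simp add: convergent_LIMSEQ_iff)
qed

lemma op_norm_sigma_down_le_1: "n \<ge> 1 \<Longrightarrow> op_norm X N (sigma_down n) \<le> 1"
  by (rule op_norm_le) (auto simp: norm_sigma_down_le)

lemma boyd_beta_nonneg: "0 \<le> boyd_beta X N"
proof (rule LIMSEQ_le_const[OF boyd_beta_limit])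
  show "\<exists>M. \<forall>n\<ge>M. 0 \<le> log 2 (op_norm X N (sigma_up n)) / log 2 (real n)"
    using op_norm_sigma_up_ge_1
    by (intro exI[of _ 1] allI impI divide_nonneg_nonneg) (fastforce intro: zero_le_log_cancel_iff[THEN iffD2])+
qed

lemma boyd_alpha_nonneg: "0 \<le> boyd_alpha X N"
proof -
  have "log 2 (op_norm X N (sigma_down n)) / log 2 (real n) \<le> 0" if n: "n \<ge> 1" for n
  proof (rule divide_nonpos_nonneg)
    have "op_norm X N (sigma_down n) > 0"
      using op_norm_sigma_down_ge[OF n] n by (auto intro: less_le_trans[rotated])
    then show "log 2 (op_norm X N (sigma_down n)) \<le> 0" using op_norm_sigma_down_le_1[OF n] by simp
  qed (use n in simp)
  then have "- boyd_alpha X N \<le> 0" by (intro LIMSEQ_le_const2[OF boyd_alpha_limit]) blast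
  then show ?thesis by simp
qed

section \<open>The indices of the fundamental function\<close>

lemma Minf_bounds:
  assumes n: "n \<ge> 1"
  shows Minf_upper: "m \<ge> 1 \<Longrightarrow> fund_fun N (m * n) / fund_fun N m \<le> Minf N n"
    and Minf_least: "(\<And>m. m \<ge> 1 \<Longrightarrow> fund_fun N (m * n) / fund_fun N m \<le> K) \<Longrightarrow> Minf N n \<le> K"
    and Minf_less: "K < Minf N n \<Longrightarrow> \<exists>m\<ge>1. K < fund_fun N (m * n) / fund_fun N m"
proof -
  let ?S = "{fund_fun N (m * n) / fund_fun N m |m. m \<ge> 1}"
  have bdd: "bdd_above ?S"
    \<comment> \<open>Boundedness makes the \<open>Sup\<close> in \<open>Minf\<close> a true
      supremum; the bound \<open>n\<close> is the triangle inequality for \<open>n\<close> disjoint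
      copies.\<close>
    by (rule bdd_aboveI[of _ "real n"])
      (use fund_fun_mult_le[OF n] fund_fun_pos in \<open>auto simp: divide_le_eq\<close>)
  have ne: "?S \<noteq> {}" by auto
  show "m \<ge> 1 \<Longrightarrow> fund_fun N (m * n) / fund_fun N m \<le> Minf N n"
    "(\<And>m. m \<ge> 1 \<Longrightarrow> fund_fun N (m * n) / fund_fun N m \<le> K) \<Longrightarrow> Minf N n \<le> K"
    "K < Minf N n \<Longrightarrow> \<exists>m\<ge>1. K < fund_fun N (m * n) / fund_fun N m"
    unfolding Minf_def using cSup_upper[OF _ bdd] cSup_least[OF ne] less_cSupD[OF ne] by blast+
qed

lemma M0_bounds:
  assumes n: "n \<ge> 1"
  shows M0_upper: "m \<ge> 1 \<Longrightarrow> fund_fun N m / fund_fun N (m * n) \<le> M0 N n"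
    and M0_least: "(\<And>m. m \<ge> 1 \<Longrightarrow> fund_fun N m / fund_fun N (m * n) \<le> K) \<Longrightarrow> M0 N n \<le> K"
    and M0_less: "K < M0 N n \<Longrightarrow> \<exists>m\<ge>1. K < fund_fun N m / fund_fun N (m * n)"
proof -
  let ?S = "{fund_fun N m / fund_fun N (m * n) |m. m \<ge> 1}"
  have "fund_fun N m / fund_fun N (m * n) \<le> 1" if "m \<ge> 1" for m
    using fund_fun_mono[of m "m * n"] fund_fun_pos[of "m * n"] n that by (simp add: divide_le_eq)
  then have bdd: "bdd_above ?S" by (intro bdd_aboveI[of _ 1]) auto
  have ne: "?S \<noteq> {}" by auto
  show "m \<ge> 1 \<Longrightarrow> fund_fun N m / fund_fun N (m * n) \<le> M0 N n"
    "(\<And>m. m \<ge> 1 \<Longrightarrow> fund_fun N m / fund_fun N (m * n) \<le> K) \<Longrightarrow> M0 N n \<le> K"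
    "K < M0 N n \<Longrightarrow> \<exists>m\<ge>1. K < fund_fun N m / fund_fun N (m * n)"
    unfolding M0_def using cSup_upper[OF _ bdd] cSup_least[OF ne] less_cSupD[OF ne] by blast+
qed

lemma fund_nu_limit: "(\<lambda>n. log 2 (Minf N n) / log 2 (real n)) \<longlonglongrightarrow> fund_nu N"
proof -
  note pos = fund_fun_pos
  have ge1: "Minf N n \<ge> 1" if n: "n \<ge> 1" for n
  proof -
    have "1 \<le> fund_fun N (1 * n) / fund_fun N 1"
      using fund_fun_mono[of 1 n] pos[of 1] n by (simp add: le_divide_eq)
    then show ?thesis using Minf_upper[OF n, of 1] by simp
  qed
  have sub: "Minf N (a * b) \<le> Minf N a * Minf N b" if ab: "a \<ge> 1" "b \<ge> 1" for a b
  proof (rule Minf_least)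
    fix m :: nat assume m: "m \<ge> 1"
    have "fund_fun N (m * (a * b)) / fund_fun N m
        = fund_fun N (m * a) / fund_fun N m * (fund_fun N (m * a * b) / fund_fun N (m * a))"
      using pos[of "m * a"] ab m by (simp add: mult.assoc)
    also have "\<dots> \<le> Minf N a * Minf N b"
      using ab m pos[of m] pos[of "m * a"] pos[of "m * a * b"] ge1[of a]
      by (intro mult_mono Minf_upper) (auto intro!: divide_nonneg_nonneg simp: less_imp_le)
    finally show "fund_fun N (m * (a * b)) / fund_fun N m \<le> Minf N a * Minf N b" .
  qed (use ab in simp)
  have mono: "Minf N n \<le> Minf N n'" if "n \<ge> 1" "n \<le> n'" for n n'
  proof (rule Minf_least[OF that(1)])
    fix m :: nat assume m: "m \<ge> 1"
    have "fund_fun N (m * n) / fund_fun N m \<le> fund_fun N (m * n') / fund_fun N m"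
      using pos[OF m] that by (intro divide_right_mono fund_fun_mono) auto
    also have "\<dots> \<le> Minf N n'" using that m by (intro Minf_upper) auto
    finally show "fund_fun N (m * n) / fund_fun N m \<le> Minf N n'" .
  qed
  have "convergent (\<lambda>n. log 2 (Minf N n) / log 2 (real n))"
  proof (rule convergent_log_ratio[OF _ _ sub])
    show "1 / real n \<le> Minf N n" if "n \<ge> 1" for n
      using ge1[OF that] that by (auto intro: order_trans[of _ 1])
    show "Minf N 1 \<le> 1" by (rule Minf_least) auto
    fix m :: nat assume m: "m \<ge> 2"
    show "\<exists>C. \<forall>n j. m ^ j \<le> n \<and> n < m ^ Suc j \<longrightarrow> Minf N n \<le> C * Minf N (m ^ j)"
    proof (intro exI allI impI)
      fix n j assume "m ^ j \<le> n \<and> n < m ^ Suc j"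
      moreover from this have "1 \<le> n" using m by (metis le_trans one_le_power one_le_numeral)
      ultimately show "Minf N n \<le> Minf N m * Minf N (m ^ j)"
        using mono[of n "m * m ^ j"] sub[of m "m ^ j"] m by simp
    qed
  qed
  then show ?thesis unfolding fund_nu_def by (simp add: convergent_LIMSEQ_iff)
qed

lemma fund_mu_limit: "(\<lambda>n. log 2 (M0 N n) / log 2 (real n)) \<longlonglongrightarrow> - fund_mu N"
proof -
  note pos = fund_fun_pos
  have ge: "M0 N n \<ge> 1 / real n" if n: "n \<ge> 1" for n
  proof -
    have "1 / real n \<le> fund_fun N 1 / fund_fun N (1 * n)"
      using fund_fun_mult_le[of n 1] pos[of n] n by (simp add: field_simps)
    then show ?thesis using M0_upper[OF n, of 1] by simp
  qed
  have nonneg: "M0 N n \<ge> 0" if "n \<ge> 1" for n using ge[OF that] by (auto intro: order_trans[rotated])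
  have sub: "M0 N (a * b) \<le> M0 N a * M0 N b" if ab: "a \<ge> 1" "b \<ge> 1" for a b
  proof (rule M0_least)
    fix m :: nat assume m: "m \<ge> 1"
    have "fund_fun N m / fund_fun N (m * (a * b))
        = fund_fun N m / fund_fun N (m * a) * (fund_fun N (m * a) / fund_fun N (m * a * b))"
      using pos[of "m * a"] ab m by (simp add: mult.assoc)
    also have "\<dots> \<le> M0 N a * M0 N b"
      using ab m pos[of m] pos[of "m * a"] pos[of "m * a * b"] nonneg[of a]
      by (intro mult_mono M0_upper) (auto intro!: divide_nonneg_nonneg simp: less_imp_le)
    finally show "fund_fun N m / fund_fun N (m * (a * b)) \<le> M0 N a * M0 N b" .
  qed (use ab in simp)
  have mono: "M0 N n' \<le> M0 N n" if "n \<ge> 1" "n \<le> n'" for n n'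
  proof (rule M0_least)
    fix m :: nat assume m: "m \<ge> 1"
    have "fund_fun N m / fund_fun N (m * n') \<le> fund_fun N m / fund_fun N (m * n)"
      using pos[OF m] pos[of "m * n"] m that by (intro divide_left_mono fund_fun_mono mult_pos_pos pos) auto
    also have "\<dots> \<le> M0 N n" using that m by (intro M0_upper) auto
    finally show "fund_fun N m / fund_fun N (m * n') \<le> M0 N n" .
  qed (use that in simp)
  have "convergent (\<lambda>n. log 2 (M0 N n) / log 2 (real n))"
  proof (rule convergent_log_ratio[OF ge _ sub])
    show "M0 N 1 \<le> 1" by (rule M0_least) auto
    fix m :: nat assume "m \<ge> 2"
    then show "\<exists>C. \<forall>n j. m ^ j \<le> n \<and> n < m ^ Suc j \<longrightarrow> M0 N n \<le> C * M0 N (m ^ j)"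
      by (intro exI[of _ 1]) (auto intro!: mono)
  qed
  then show ?thesis unfolding fund_mu_def by (simp add: convergent_LIMSEQ_iff)
qed

section \<open>Approximate eigenvectors of the dilations\<close>

text \<open>Since \<open>fund_nu N\<close> is the growth exponent of \<open>Minf\<close>, for large
  \<open>n\<close> some \<open>m\<close> has \<open>fund_fun N (m * n)\<close> above
  \<open>n^(q - d/2) * fund_fun N m\<close>. Half of \<open>d\<close> is spent on this
  approximation; the other half gives the surplus \<open>n^(d/2)\<close>, which covers both
  \<open>h\<close> and the factor \<open>A0\<close> lost when \<open>m\<close> is replaced by
  \<open>m * A0\<close> to get beyond \<open>A0\<close>.\<close>

lemma exists_growth:
  assumes q: "q \<le> fund_nu N" and d: "d > 0" and h: "h > 0" and A0: "A0 \<ge> 1"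
  obtains A k where "A0 \<le> A" "A \<le> k"
    "fund_fun N A * real A powr (d - q) \<le> h * (fund_fun N k * real k powr (d - q))"
proof -
  have "eventually (\<lambda>n. q - d / 2 < log 2 (Minf N n) / log 2 (real n)) sequentially"
    using q d by (intro order_tendstoD(1)[OF fund_nu_limit]) simp
  moreover have "(\<lambda>n. real A0 * real n powr (- (d / 2))) \<longlonglongrightarrow> 0" using d by real_asymp
  then have "eventually (\<lambda>n. real A0 * real n powr (- (d / 2)) < h) sequentially"
    using h by (rule order_tendstoD(2))
  ultimately have "eventually (\<lambda>n. q - d / 2 < log 2 (Minf N n) / log 2 (real n)
      \<and> real A0 * real n powr (- (d / 2)) < h \<and> n \<ge> 2) sequentially"
    using eventually_ge_at_top[of 2] by eventually_elim auto
  then obtain n where n: "q - d / 2 < log 2 (Minf N n) / log 2 (real n)"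
    "real A0 * real n powr (- (d / 2)) < h" "n \<ge> 2"
    using eventually_happens'[OF sequentially_bot] by blast
  have n1: "n \<ge> 1" using n by simp
  have "Minf N n > 0"
    using Minf_upper[OF n1, of 1] fund_fun_pos[of n] fund_fun_pos[of 1] n1
    by (auto intro: less_le_trans[rotated])
  moreover have "log 2 (real n powr (q - d / 2)) < log 2 (Minf N n)"
    using n by (simp add: log_powr pos_less_divide_eq)
  ultimately have "real n powr (q - d / 2) < Minf N n" using n by (subst (asm) log_less_cancel_iff) auto
  from Minf_less[OF n1 this] obtain m where
    m: "m \<ge> 1" "real n powr (q - d / 2) < fund_fun N (m * n) / fund_fun N m" by blast
  then have m2: "real n powr (q - d / 2) * fund_fun N m \<le> fund_fun N (m * n)"
    using fund_fun_pos[OF m(1)] by (simp add: pos_less_divide_eq)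
  have eq: "real n powr (q - d) = real n powr (- (d / 2)) * real n powr (q - d / 2)"
    by (simp add: powr_add[symmetric])
  have "fund_fun N (m * A0) * real n powr (q - d)
      \<le> (real A0 * fund_fun N m) * real n powr (q - d)"
    using fund_fun_mult_le[OF A0, of m] by (intro mult_right_mono) auto
  also have "\<dots> = (real A0 * real n powr (- (d / 2))) * (real n powr (q - d / 2) * fund_fun N m)"
    unfolding eq by simp
  also have "\<dots> \<le> h * fund_fun N (m * A0 * n)"
  proof (rule mult_mono)
    have "fund_fun N (m * n) \<le> fund_fun N (m * A0 * n)" using A0 by (intro fund_fun_mono) simp
    then show "real n powr (q - d / 2) * fund_fun N m \<le> fund_fun N (m * A0 * n)" using m2 by linarith
  qed (use n h fund_fun_pos[OF m(1)] in auto)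
  finally have main: "fund_fun N (m * A0) * real n powr (q - d) \<le> h * fund_fun N (m * A0 * n)" .
  have "real n powr (q - d) * real (m * A0 * n) powr (d - q) = real (m * A0) powr (d - q)"
    using n by (simp add: powr_mult powr_add[symmetric] mult.left_commute)
  then have "fund_fun N (m * A0) * real (m * A0) powr (d - q)
      = (fund_fun N (m * A0) * real n powr (q - d)) * real (m * A0 * n) powr (d - q)" by (simp add: mult.assoc)
  also have "\<dots> \<le> (h * fund_fun N (m * A0 * n)) * real (m * A0 * n) powr (d - q)"
    using main by (rule mult_right_mono) simp
  finally show ?thesis using m n by (intro that[of "m * A0" "m * A0 * n"]) auto
qed

text \<open>The mirror image, with \<open>M0\<close> and \<open>fund_mu\<close>; here the factor
  \<open>A0\<close> is lost at the far end \<open>m * A0 * n\<close>. Taking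
  \<open>n \<ge> 2\<close> gives \<open>2 * k \<le> B\<close>, which leaves room for the window from
  \<open>k\<close> to \<open>2 * k\<close> used later to bound a norm from below.\<close>

lemma exists_decay:
  assumes q: "fund_mu N \<le> q" and d: "d > 0" and h: "h > 0" and A0: "A0 \<ge> 1"
  obtains k B where "A0 \<le> k" "2 * k \<le> B"
    "fund_fun N B * real B powr (- q - d) \<le> h * (fund_fun N k * real k powr (- q - d))"
proof -
  have "eventually (\<lambda>n. - q - d / 2 < log 2 (M0 N n) / log 2 (real n)) sequentially"
    using q d by (intro order_tendstoD(1)[OF fund_mu_limit]) simp
  moreover have "(\<lambda>n. real A0 * real n powr (- (d / 2))) \<longlonglongrightarrow> 0" using d by real_asymp
  then have "eventually (\<lambda>n. real A0 * real n powr (- (d / 2)) < h) sequentially"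
    using h by (rule order_tendstoD(2))
  ultimately have "eventually (\<lambda>n. - q - d / 2 < log 2 (M0 N n) / log 2 (real n)
      \<and> real A0 * real n powr (- (d / 2)) < h \<and> n \<ge> 2) sequentially"
    using eventually_ge_at_top[of 2] by eventually_elim auto
  then obtain n where n: "- q - d / 2 < log 2 (M0 N n) / log 2 (real n)"
    "real A0 * real n powr (- (d / 2)) < h" "n \<ge> 2"
    using eventually_happens'[OF sequentially_bot] by blast
  have n1: "n \<ge> 1" using n by simp
  have "M0 N n > 0"
    using M0_upper[OF n1, of 1] fund_fun_pos[of n] fund_fun_pos[of 1] n1
    by (auto intro: less_le_trans[rotated])
  moreover have "log 2 (real n powr (- q - d / 2)) < log 2 (M0 N n)"
    using n by (simp add: log_powr pos_less_divide_eq)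
  ultimately have "real n powr (- q - d / 2) < M0 N n" using n by (subst (asm) log_less_cancel_iff) auto
  from M0_less[OF n1 this] obtain m where
    m: "m \<ge> 1" "real n powr (- q - d / 2) < fund_fun N m / fund_fun N (m * n)" by blast
  then have m2: "real n powr (- q - d / 2) * fund_fun N (m * n) \<le> fund_fun N m"
    using fund_fun_pos[of "m * n"] n1 by (simp add: pos_less_divide_eq)
  have eq: "real n powr (- q - d) = real n powr (- (d / 2)) * real n powr (- q - d / 2)"
    by (simp add: powr_add[symmetric] minus_diff_commute)
  have "fund_fun N (m * A0 * n) * real n powr (- q - d)
      \<le> (real A0 * fund_fun N (m * n)) * real n powr (- q - d)"
    using fund_fun_mult_le[OF A0, of "m * n"] by (intro mult_right_mono) (auto simp: mult.commute mult.left_commute)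
  also have "\<dots> = (real A0 * real n powr (- (d / 2))) * (real n powr (- q - d / 2) * fund_fun N (m * n))"
    unfolding eq by simp
  also have "\<dots> \<le> h * fund_fun N (m * A0)"
  proof (rule mult_mono)
    have "fund_fun N m \<le> fund_fun N (m * A0)" using A0 by (intro fund_fun_mono) simp
    then show "real n powr (- q - d / 2) * fund_fun N (m * n) \<le> fund_fun N (m * A0)" using m2 by linarith
  qed (use n h m fund_fun_pos[of "m * n"] in auto)
  finally have main: "fund_fun N (m * A0 * n) * real n powr (- q - d) \<le> h * fund_fun N (m * A0)" .
  have "real (m * A0 * n) powr (- q - d) = real n powr (- q - d) * real (m * A0) powr (- q - d)"
    by (simp add: powr_mult)
  then have "fund_fun N (m * A0 * n) * real (m * A0 * n) powr (- q - d)
      = (fund_fun N (m * A0 * n) * real n powr (- q - d)) * real (m * A0) powr (- q - d)"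
    by (simp add: mult.assoc)
  also have "\<dots> \<le> (h * fund_fun N (m * A0)) * real (m * A0) powr (- q - d)"
    using main by (rule mult_right_mono) simp
  finally show ?thesis using m n by (intro that[of "m * A0" "m * A0 * n"]) auto
qed

text \<open>A rise followed by a fall does not immediately give a peak, as the rise may end far below the start
  of the fall; \<open>k\<close> is the maximum point of the rising weight between the two.\<close>

lemma exists_peak:
  assumes q: "fund_mu N \<le> q" "q \<le> fund_nu N" and d: "d > 0" and h: "h > 0" and A0: "A0 \<ge> 1"
  obtains A k B where "A0 \<le> A" "A \<le> k" "2 * k \<le> B"
    "fund_fun N A * (real A / real k) powr (d - q) \<le> h * fund_fun N k"
    "fund_fun N B * (real B / real k) powr (- q - d) \<le> h * fund_fun N k"
proof -
  obtain A k0 where A: "A0 \<le> A" "A \<le> k0"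
    "fund_fun N A * real A powr (d - q) \<le> h * (fund_fun N k0 * real k0 powr (d - q))"
    using exists_growth[OF q(2) d h A0] by blast
  obtain m B where B: "k0 \<le> m" "2 * m \<le> B"
    "fund_fun N B * real B powr (- q - d) \<le> h * (fund_fun N m * real m powr (- q - d))"
    using exists_decay[OF q(1) d h, of k0] A A0 by auto
  define g where "g i = fund_fun N i * real i powr (d - q)" for i
  have "Max (g ` {A..m}) \<in> g ` {A..m}" using A B by (intro Max_in) auto
  then obtain k where k: "A \<le> k" "k \<le> m" "g k = Max (g ` {A..m})" by auto
  have gk: "g i \<le> g k" if "A \<le> i" "i \<le> m" for i unfolding k(3) using that by (intro Max_ge) auto
  have k1: "k \<ge> 1" using k A A0 by simp
  have "fund_fun N A * real A powr (d - q) \<le> h * g k"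
    using A(3) gk[of k0] A B h mult_left_mono[of "g k0" "g k" h] unfolding g_def by linarith
  then have 1: "fund_fun N A * (real A / real k) powr (d - q) \<le> h * fund_fun N k"
    using k1 unfolding g_def by (simp add: powr_divide field_simps)
  \<comment> \<open>The falling weight is the rising weight \<open>g\<close> times a decreasing
    power. At \<open>k \<le> m\<close>, where \<open>g\<close> is maximal, it is therefore at least
    its value at \<open>m\<close>.\<close>
  have eq: "fund_fun N i * real i powr (- q - d) = g i * real i powr (- (2 * d))" for i
    unfolding g_def by (simp add: mult.assoc powr_add[symmetric] minus_diff_commute)
  have "g m * real m powr (- (2 * d)) \<le> g k * real k powr (- (2 * d))"
  proof (rule mult_mono)
    show "g m \<le> g k" using gk[of m] k(1,2) by simp
    show "real m powr (- (2 * d)) \<le> real k powr (- (2 * d))"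
      using k(2) k1 d by (intro powr_mono2') auto
    show "0 \<le> g k" unfolding g_def using fund_fun_pos[OF k1] by simp
  qed simp
  then have "fund_fun N B * real B powr (- q - d) \<le> h * (fund_fun N k * real k powr (- q - d))"
    using B(3) h mult_left_mono[of "g m * real m powr (- (2 * d))" "g k * real k powr (- (2 * d))" h]
    unfolding eq by linarith
  then have 2: "fund_fun N B * (real B / real k) powr (- q - d) \<le> h * fund_fun N k"
    using k1 by (simp add: powr_divide field_simps)
  show ?thesis using that[OF A(1) k(1) _ 1 2] k B by simp
qed

end

text \<open>This is \<open>(s/k)\<^sup>-\<^sup>q min ((s/k)\<^sup>d) ((k/s)\<^sup>d)\<close>, written so that ratios are governed by the triangle
  inequality in the exponent.\<close>

definition profile :: "real \<Rightarrow> real \<Rightarrow> real \<Rightarrow> real \<Rightarrow> real" where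
  "profile q d k s = exp (- q * ln (s / k) - d * \<bar>ln (s / k)\<bar>)"

text \<open>On a logarithmic scale the slope of the profile lies between \<open>- q - d\<close> and
  \<open>d - q\<close>. So the profile is the power with exponent \<open>- q\<close> up to a factor
  \<open>(s' / s) powr d\<close> either way, independently of where \<open>k\<close> lies.\<close>

lemma profile_ratio:
  assumes "0 < s" "s \<le> s'" "0 < k" "0 \<le> d"
  shows profile_upper: "profile q d k s' \<le> (s' / s) powr (d - q) * profile q d k s"
    and profile_lower: "profile q d k s \<le> (s' / s) powr (q + d) * profile q d k s'"
proof -
  define l l' where "l = ln (s / k)" and "l' = ln (s' / k)"
  have ln: "ln (s' / s) = l' - l" unfolding l_def l'_def using assms by (simp add: ln_div)
  have "l \<le> l'" unfolding l_def l'_def using assms by (simp add: divide_right_mono)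
  then have "d * (\<bar>l\<bar> - \<bar>l'\<bar>) \<le> d * (l' - l)" "d * (\<bar>l'\<bar> - \<bar>l\<bar>) \<le> d * (l' - l)"
    using assms by (intro mult_left_mono; linarith)+
  then show "profile q d k s' \<le> (s' / s) powr (d - q) * profile q d k s"
    "profile q d k s \<le> (s' / s) powr (q + d) * profile q d k s'"
    using assms unfolding profile_def l_def[symmetric] l'_def[symmetric]
    by (simp_all add: powr_def ln exp_add[symmetric] algebra_simps)
qed

text \<open>These identify the profile at \<open>A\<close> and at \<open>B\<close> with the weights
  in \<open>exists_peak\<close>.\<close>

lemma profile_le: "0 < s \<Longrightarrow> s \<le> k \<Longrightarrow> profile q d k s = (s / k) powr (d - q)"
  and profile_ge: "0 < k \<Longrightarrow> k \<le> s \<Longrightarrow> profile q d k s = (s / k) powr (- q - d)"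
  by (auto simp: profile_def powr_def abs_if algebra_simps)

lemma profile_pos: "profile q d k s > 0"
  by (simp add: profile_def)

context symmetric_space
begin

text \<open>One finitely supported \<open>x\<close> serves all dilations up to \<open>R\<close>.
  From \<open>0 \<le> q \<le> 1\<close> and \<open>0 < d \<le> 1\<close> the exponents
  \<open>d - q\<close> and \<open>q + d\<close> are at most 1 and 2, which is where the powers of
  \<open>R\<close> and the factors 4 below come from.\<close>

lemma approx_eigenvector:
  assumes q: "fund_mu N \<le> q" "q \<le> fund_nu N" "0 \<le> q" "q \<le> 1" and R: "R \<ge> 1" and e: "e > 0"
  obtains x L where "\<And>i. i \<ge> L \<Longrightarrow> x i = 0" "N x = 1"
    "\<And>r. 1 \<le> r \<Longrightarrow> r \<le> R \<Longrightarrow> N (\<lambda>i. sigma_up r x i - real r powr q * x i) \<le> e"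
proof -
  define e1 where "e1 = e / (2 * real R)"
  have e1: "e1 > 0" unfolding e1_def using e R by simp
  \<comment> \<open>The two truncation errors add up to at most
    \<open>5 * R^3 * h * fund_fun N k\<close>, and \<open>fund_fun N k \<le> 4 * N x\<close>; the 40
    makes this \<open>e / 2 * N x\<close>. The interior error \<open>e1 * R * N x\<close> is the
    other half.\<close>
  define h where "h = e / (40 * real R ^ 3)"
  have h: "h > 0" unfolding h_def using e R by simp
  have R1: "real R \<ge> 1" using R by simp
  have "(\<lambda>n. (1 + 1 / real n) ^ 2 * (2 * real R) powr (1 / real n)) \<longlonglongrightarrow> 1"
    using R1 by real_asymp
  then have "eventually (\<lambda>n. (1 + 1 / real n) ^ 2 * (2 * real R) powr (1 / real n) < 1 + e1) sequentially"
    using e1 by (intro order_tendstoD(2)) auto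
  then have "eventually (\<lambda>n. (1 + 1 / real n) ^ 2 * (2 * real R) powr (1 / real n) < 1 + e1 \<and> n \<ge> 1) sequentially"
    using eventually_ge_at_top[of 1] by eventually_elim auto
  then obtain A0 where A0: "(1 + 1 / real A0) ^ 2 * (2 * real R) powr (1 / real A0) < 1 + e1" "A0 \<ge> 1"
    using eventually_happens'[OF sequentially_bot] by blast
  \<comment> \<open>One large \<open>A0\<close> controls two errors: \<open>d\<close> is small, and
    \<open>1 / s \<le> d\<close> for all \<open>s \<ge> A\<close>, which bounds the rounding in
    \<open>i div r\<close>.\<close>
  define d where "d = 1 / real A0"
  have d: "0 < d" "d \<le> 1" unfolding d_def using A0 by auto
  have d1: "(1 + d) ^ 2 * (2 * real R) powr d < 1 + e1" using A0 unfolding d_def by simp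
  obtain A k B where A: "A0 \<le> A" "A \<le> k" "2 * k \<le> B"
    and low: "fund_fun N A * (real A / real k) powr (d - q) \<le> h * fund_fun N k"
    and high: "fund_fun N B * (real B / real k) powr (- q - d) \<le> h * fund_fun N k"
    using exists_peak[OF q(1,2) d(1) h A0(2)] by blast
  have nat: "1 \<le> A" "1 \<le> k" "1 \<le> B" "A < B" "k \<le> B" using A A0 by auto
  define F where "F = (\<lambda>s. profile q d (real k) (real s))"
  have Fpos: "F s > 0" for s unfolding F_def by (rule profile_pos)
  have Fup: "F s' \<le> (real s' / real s) powr (d - q) * F s"
    and Flow: "F s \<le> (real s' / real s) powr (q + d) * F s'" if "1 \<le> s" "s \<le> s'" for s s'
    unfolding F_def using that nat d by (intro profile_upper profile_lower; simp)+
  have FA: "fund_fun N A * F A \<le> h * fund_fun N k"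
    using low nat A unfolding F_def by (simp add: profile_le)
  have FB: "fund_fun N B * F B \<le> h * fund_fun N k"
    using high nat A unfolding F_def by (simp add: profile_ge)
  have Fk: "F k = 1" unfolding F_def using nat by (simp add: profile_le)
  \<comment> \<open>The profile is frozen at its value at \<open>A\<close> on the left, which also
    avoids \<open>ln 0\<close> at \<open>i = 0\<close>, and cut off at \<open>B\<close> on the
    right.\<close>
  define x where "x i = (if i < B then F (max i A) else 0)" for i
  have x0: "x i \<ge> 0" for i unfolding x_def using Fpos by (simp add: less_imp_le)
  have xX: "x \<in> X" by (rule finite_support_mem[of B]) (simp add: x_def)
  have Nx: "fund_fun N k \<le> 4 * N x"
  proof -
    \<comment> \<open>From its value 1 at \<open>k\<close> the profile falls by at most a factor
      \<open>2 powr (q + d) \<le> 4\<close> on this window, which has \<open>k\<close> elements and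
      ends before the cut-off.\<close>
    have "\<bar>indicat_real {k..<2 * k} i\<bar> \<le> \<bar>4 * x i\<bar>" for i
    proof (cases "i \<in> {k..<2 * k}")
      case True
      then have i: "k \<le> i" "i < 2 * k" by auto
      have "1 \<le> (real i / real k) powr (q + d) * F i" using Flow[of k i] Fk i nat by simp
      also have "\<dots> \<le> 4 * F i"
      proof (rule mult_right_mono)
        have "(real i / real k) powr (q + d) \<le> 2 powr (q + d)"
          using i nat q d by (intro powr_mono2) (auto simp: divide_le_eq)
        also have "\<dots> \<le> 2 powr 2" using q d by (intro powr_mono) auto
        finally show "(real i / real k) powr (q + d) \<le> 4" by simp
      qed (use Fpos[of i] in simp)
      also have "F i = x i" unfolding x_def using i A by simp
      finally show ?thesis using True by simp
    qed (use x0[of i] in simp)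
    then have "N (indicat_real {k..<2 * k}) \<le> N (\<lambda>i. 4 * x i)" by (rule dominated[OF scale_mem[OF xX]])
    then show ?thesis using norm_scale[OF xX, of 4] norm_indicator[of "{k..<2 * k}"] by simp
  qed
  then have Nxpos: "N x > 0" using fund_fun_pos[OF nat(2)] by simp
  have eig: "N (\<lambda>i. sigma_up r x i - real r powr q * x i) \<le> e * N x" if r: "1 \<le> r" "r \<le> R" for r
  proof -
    have r1: "1 \<le> real r" "real r \<le> real R" using r by auto
    have rq: "1 \<le> real r powr q" "real r powr q \<le> real R"
    proof -
      show "1 \<le> real r powr q" using r1 q by (simp add: ge_one_powr_ge_zero)
      have "real r powr q \<le> real r powr 1" using r1 q by (intro powr_mono) auto
      then show "real r powr q \<le> real R" using r1 by simp
    qed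
    define g where "g i = e1 * real R * x i + real R ^ 2 * F A * indicat_real {..<A * R} i
        + 4 * real R ^ 2 * F B * indicat_real {..<B * R} i" for i
    have bound: "\<bar>sigma_up r x i - real r powr q * x i\<bar> \<le> \<bar>g i\<bar>" for i
    proof -
      have g: "e1 * real R * x i \<le> g i" "real R ^ 2 * F A * indicat_real {..<A * R} i \<le> g i"
        "4 * real R ^ 2 * F B * indicat_real {..<B * R} i \<le> g i" "0 \<le> g i"
        unfolding g_def using e1 x0[of i] Fpos[of A] Fpos[of B]
        by (auto intro!: add_nonneg_nonneg mult_nonneg_nonneg simp: less_imp_le)
      define s where "s = i div r"
      have s: "s * r \<le> i" "i < s * r + r"
        using r dividend_less_div_times[of r i] unfolding s_def by (auto simp: div_times_less_eq_dividend add.commute)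
      have up: "sigma_up r x i = x s" by (simp add: sigma_up_def s_def)
      consider "s < A" | "A \<le> s" "i < B" | "A \<le> s" "B \<le> i" by linarith
      then show ?thesis
      proof cases
        case 1
        have "s * r + r \<le> A * r" using 1 mult_le_mono1[of "Suc s" A r] by simp
        also have "\<dots> \<le> A * R" using r by simp
        finally have i: "i < A * R" using s by simp
        have xs: "x s = F A" unfolding x_def using 1 nat by (simp add: max_def)
        have "x i \<le> real R * F A"
        proof (cases "i < B")
          case True
          let ?s = "max i A"
          have "real ?s \<le> real (A * R)" using i R by (intro of_nat_mono) auto
          then have ratio: "1 \<le> real ?s / real A" "real ?s / real A \<le> real R"
            using nat by (auto simp: field_simps)
          have "x i = F ?s" unfolding x_def using True by simp
          also have "\<dots> \<le> (real ?s / real A) powr (d - q) * F A" using nat by (intro Fup) auto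
          also have "\<dots> \<le> (real ?s / real A) powr 1 * F A"
            using ratio q d Fpos[of A] by (intro mult_right_mono powr_mono) auto
          also have "\<dots> \<le> real R * F A" using ratio Fpos[of A] by (intro mult_right_mono) auto
          finally show ?thesis .
        qed (use Fpos[of A] in \<open>simp add: x_def\<close>)
        then have "real r powr q * x i \<le> real R * (real R * F A)"
          using rq x0[of i] by (intro mult_mono) auto
        moreover have "F A \<le> real R ^ 2 * F A" using R1 Fpos[of A] by simp
        moreover have "0 \<le> real r powr q * x i" "0 \<le> F A" using x0[of i] Fpos[of A] by auto
        ultimately have "\<bar>sigma_up r x i - real r powr q * x i\<bar> \<le> real R ^ 2 * F A"
          unfolding up xs by (simp add: power2_eq_square abs_le_iff)
        then show ?thesis using g(2,4) i by simp
      next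
        case 2
        have i1: "1 \<le> s" "s \<le> i" "A \<le> i" using 2 nat s r
          by (auto simp: s_def intro: order_trans[OF _ div_le_dividend])
        have xs: "x s = F s" "x i = F i" unfolding x_def using 2 i1 by (simp_all add: max.absorb1)
        \<comment> \<open>Up to the exponent \<open>d\<close> the value drops from \<open>s\<close>
          to \<open>i\<close> by \<open>t powr q\<close>, and \<open>t\<close> lies between
          \<open>r\<close> and \<open>r * (1 + 1 / s)\<close> because \<open>s\<close> is the
          rounded quotient.\<close>
        define t where "t = real i / real s"
        have "real s * real r \<le> real i" using s by (metis of_nat_le_iff of_nat_mult)
        then have t1: "real r \<le> t" unfolding t_def using i1 by (simp add: field_simps)
        have "real i \<le> real (s * r + r)" using s by (intro of_nat_mono) simp
        also have "\<dots> = real s * (real r * (1 + 1 / real s))" using i1 by (simp add: field_simps)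
        finally have "real i \<le> real s * (real r * (1 + 1 / real s))" .
        then have "t \<le> real r * (1 + 1 / real s)"
          using pos_divide_le_eq[of "real s" "real i" "real r * (1 + 1 / real s)"] i1
          unfolding t_def by (simp only: mult.commute)
        also have "\<dots> \<le> real r * (1 + d)"
          using 2 A A0 i1 unfolding d_def by (intro mult_left_mono add_left_mono frac_le) auto
        finally have t2: "t \<le> real r * (1 + d)" .
        have t3: "t \<le> 2 * real R" using t2 mult_mono[of "real r" "real R" "1 + d" 2] r1 d by simp
        have tpos: "0 < t" using t1 r1 by simp
        have td: "t powr d \<le> (2 * real R) powr d" using t3 tpos d by (intro powr_mono2) auto
        have "t powr q \<le> (real r * (1 + d)) powr q" using t2 tpos q by (intro powr_mono2) auto
        also have "\<dots> = real r powr q * (1 + d) powr q" using d by (simp add: powr_mult)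
        also have "\<dots> \<le> real r powr q * (1 + d) ^ 2"
        proof (rule mult_left_mono)
          have "(1 + d) powr q \<le> (1 + d) powr 2" using q d by (intro powr_mono) auto
          then show "(1 + d) powr q \<le> (1 + d) ^ 2" using d by (simp add: powr_realpow)
        qed simp
        finally have tq: "t powr q \<le> real r powr q * (1 + d) ^ 2" .
        have "t powr (q + d) \<le> (real r powr q * (1 + d) ^ 2) * (2 * real R) powr d"
          unfolding powr_add using tq td by (intro mult_mono) auto
        also have "\<dots> \<le> real r powr q * (1 + e1)"
          unfolding mult.assoc using d1 by (intro mult_left_mono) auto
        finally have upper: "F s \<le> real r powr q * (1 + e1) * F i"
          using Flow[OF i1(1,2)] Fpos[of i] mult_right_mono[of "t powr (q + d)" _ "F i"]
          unfolding t_def by (meson less_imp_le order_trans)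
        have "F i \<le> t powr (d - q) * F s" using Fup[OF i1(1,2)] unfolding t_def .
        then have "t powr q * F i \<le> t powr q * (t powr (d - q) * F s)" by (intro mult_left_mono) auto
        also have "\<dots> = t powr d * F s" by (simp add: mult.assoc[symmetric] powr_add[symmetric])
        also have "\<dots> \<le> (1 + e1) * F s"
        proof (rule mult_right_mono)
          have "1 * (2 * real R) powr d \<le> (1 + d) ^ 2 * (2 * real R) powr d"
            using d by (intro mult_right_mono) auto
          then show "t powr d \<le> 1 + e1" using td d1 by linarith
        qed (use Fpos[of s] in simp)
        finally have "t powr q * F i \<le> (1 + e1) * F s" .
        moreover have "real r powr q * F i \<le> t powr q * F i"
          using t1 r1 q Fpos[of i] by (intro mult_right_mono powr_mono2) auto
        ultimately have lower: "real r powr q * F i \<le> (1 + e1) * F s" by simp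
        \<comment> \<open>This replaces the factor \<open>1 / (1 + e1)\<close> by
          \<open>1 - e1\<close> to obtain a symmetric error; the multiplication needs
          \<open>1 - e1\<close> nonnegative, and for \<open>e1 > 1\<close> the claim is a matter of
          signs.\<close>
        have "(1 - e1) * (real r powr q * F i) \<le> F s"
        proof (cases "e1 \<le> 1")
          case True
          then have "(1 - e1) * (real r powr q * F i) \<le> (1 - e1) * ((1 + e1) * F s)"
            using lower by (intro mult_left_mono) auto
          also have "\<dots> = F s - e1 ^ 2 * F s" by (simp add: algebra_simps power2_eq_square)
          also have "\<dots> \<le> F s" using Fpos[of s] by simp
          finally show ?thesis .
        next
          case False
          then have "(1 - e1) * (real r powr q * F i) \<le> 0"
            using Fpos[of i] by (intro mult_nonpos_nonneg) auto
          then show ?thesis using Fpos[of s] by linarith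
        qed
        with upper have "\<bar>F s - real r powr q * F i\<bar> \<le> e1 * (real r powr q * F i)"
          by (simp add: abs_le_iff algebra_simps)
        also have "\<dots> \<le> e1 * (real R * F i)"
          using e1 rq Fpos[of i] by (intro mult_left_mono mult_right_mono) auto
        finally show ?thesis using g(1,4) unfolding up xs by simp
      next
        case 3
        have xi: "x i = 0" unfolding x_def using 3 by simp
        show ?thesis
        proof (cases "s < B")
          case True
          have s1: "1 \<le> s" using 3 nat by simp
          have "s * r + r \<le> B * r" using True mult_le_mono1[of "Suc s" B r] by simp
          also have "\<dots> \<le> B * R" using r by simp
          finally have i: "i < B * R" using s by simp
          \<comment> \<open>A source before the cut-off whose image is beyond it lies within a
            factor \<open>2 * R\<close> of \<open>B\<close>, so its value is comparable to
            \<open>F B\<close>.\<close>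
          have "B \<le> s * r + r" using s 3 by simp
          also have "\<dots> \<le> s * R + s * R" using s1 r mult_le_mono[of 1 s r R] by (intro add_mono) auto
          also have "\<dots> = 2 * s * R" by simp
          finally have "real B \<le> real (2 * s * R)" by (rule of_nat_mono)
          then have ratio: "1 \<le> real B / real s" "real B / real s \<le> 2 * real R"
            using True s1 by (auto simp: field_simps)
          have "x s = F s" unfolding x_def using 3 True by (simp add: max_def)
          also have "\<dots> \<le> (real B / real s) powr (q + d) * F B" using s1 True by (intro Flow) auto
          also have "\<dots> \<le> (real B / real s) powr 2 * F B"
            using ratio q d Fpos[of B] by (intro mult_right_mono powr_mono) auto
          also have "\<dots> \<le> (2 * real R) powr 2 * F B"
            using ratio Fpos[of B] by (intro mult_right_mono powr_mono2) auto
          also have "\<dots> = 4 * real R ^ 2 * F B" using R1 by (simp add: powr_numeral power_mult_distrib)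
          finally show ?thesis using g(3,4) i x0[of s] unfolding up xi by simp
        qed (use up xi g in \<open>simp add: x_def\<close>)
      qed
    qed
    have ind: "indicat_real {..<A * R} \<in> X" "indicat_real {..<B * R} \<in> X"
      by (auto intro: indicator_mem)
    have g1: "(\<lambda>i. e1 * real R * x i + real R ^ 2 * F A * indicat_real {..<A * R} i) \<in> X"
      using add_mem[OF scale_mem[OF xX] scale_mem[OF ind(1)]] by simp
    have gX: "g \<in> X"
      using add_mem[OF g1 scale_mem[OF ind(2), of "4 * real R ^ 2 * F B"]] unfolding g_def by simp
    have "N (\<lambda>i. sigma_up r x i - real r powr q * x i) \<le> N g" by (rule dominated[OF gX bound])
    also have "\<dots> \<le> N (\<lambda>i. e1 * real R * x i + real R ^ 2 * F A * indicat_real {..<A * R} i)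
        + N (\<lambda>i. 4 * real R ^ 2 * F B * indicat_real {..<B * R} i)"
      unfolding g_def by (rule norm_add[OF g1 scale_mem[OF ind(2)]])
    also have "\<dots> \<le> N (\<lambda>i. e1 * real R * x i) + N (\<lambda>i. real R ^ 2 * F A * indicat_real {..<A * R} i)
        + N (\<lambda>i. 4 * real R ^ 2 * F B * indicat_real {..<B * R} i)"
      by (intro add_right_mono norm_add scale_mem xX ind)
    also have "\<dots> = e1 * real R * N x + real R ^ 2 * F A * fund_fun N (A * R)
        + 4 * real R ^ 2 * F B * fund_fun N (B * R)"
      using e1 R1 Fpos[of A] Fpos[of B] norm_scale[OF xX] norm_scale[OF ind(1)] norm_scale[OF ind(2)]
      by (simp add: fund_fun_eq abs_mult)
    also have "\<dots> \<le> e / 2 * N x + real R ^ 3 * (h * fund_fun N k) + 4 * real R ^ 3 * (h * fund_fun N k)"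
    proof (intro add_mono)
      show "e1 * real R * N x \<le> e / 2 * N x" unfolding e1_def using R1 by simp
      have "real R ^ 2 * F A * fund_fun N (A * R) \<le> real R ^ 2 * F A * (real R * fund_fun N A)"
        using Fpos[of A] R by (intro mult_left_mono fund_fun_mult_le) auto
      also have "\<dots> = real R ^ 3 * (fund_fun N A * F A)" by (simp add: power2_eq_square power3_eq_cube)
      also have "\<dots> \<le> real R ^ 3 * (h * fund_fun N k)" using FA by (intro mult_left_mono) auto
      finally show "real R ^ 2 * F A * fund_fun N (A * R) \<le> real R ^ 3 * (h * fund_fun N k)" .
      have "4 * real R ^ 2 * F B * fund_fun N (B * R) \<le> 4 * real R ^ 2 * F B * (real R * fund_fun N B)"
        using Fpos[of B] R by (intro mult_left_mono fund_fun_mult_le) auto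
      also have "\<dots> = 4 * real R ^ 3 * (fund_fun N B * F B)" by (simp add: power2_eq_square power3_eq_cube)
      also have "\<dots> \<le> 4 * real R ^ 3 * (h * fund_fun N k)" using FB by (intro mult_left_mono) auto
      finally show "4 * real R ^ 2 * F B * fund_fun N (B * R) \<le> 4 * real R ^ 3 * (h * fund_fun N k)" .
    qed
    also have "\<dots> = e / 2 * N x + e / 8 * fund_fun N k" unfolding h_def using R1 by (simp add: field_simps)
    also have "\<dots> \<le> e / 2 * N x + e / 8 * (4 * N x)" using Nx e by (intro add_left_mono mult_left_mono) auto
    also have "\<dots> = e * N x" by simp
    finally show ?thesis .
  qed
  define y where "y i = 1 / N x * x i" for i
  show ?thesis
  proof (rule that[of B y])
    show "y i = 0" if "i \<ge> B" for i using that by (simp add: y_def x_def)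
    show "N y = 1" using norm_scale[OF xX, of "1 / N x"] Nxpos unfolding y_def by simp
    fix r assume r: "1 \<le> r" "r \<le> R"
    have "(\<lambda>i. sigma_up r y i - real r powr q * y i)
        = (\<lambda>i. 1 / N x * (sigma_up r x i - real r powr q * x i))"
      by (auto simp: fun_eq_iff y_def sigma_up_def diff_divide_distrib)
    moreover have "(\<lambda>i. sigma_up r x i - real r powr q * x i) \<in> X"
      using r by (intro diff_mem sigma_up_mem scale_mem xX)
    ultimately have "N (\<lambda>i. sigma_up r y i - real r powr q * y i)
        = 1 / N x * N (\<lambda>i. sigma_up r x i - real r powr q * x i)"
      using norm_scale[of "\<lambda>i. sigma_up r x i - real r powr q * x i" "1 / N x"] Nxpos by simp
    also have "\<dots> \<le> 1 / N x * (e * N x)" using Nxpos by (intro mult_left_mono eig r) auto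
    finally show "N (\<lambda>i. sigma_up r y i - real r powr q * y i) \<le> e" using Nxpos by simp
  qed
qed

section \<open>Representation of \<open>\<ell>\<^sup>p\<close>\<close>

text \<open>There are \<open>n + 1\<close> errors of size \<open>e\<close>: one for each piece
  replaced by a dilate of \<open>x\<close>, and one for the dilate by the total, of which the
  interleaved dilates are an exact rearrangement.\<close>

lemma norm_interleave_powr:
  assumes fin: "\<And>i. i \<ge> L \<Longrightarrow> x i = 0" and Nx: "N x = 1" and n: "n \<ge> 1"
    and eig: "\<And>r. 1 \<le> r \<Longrightarrow> r \<le> R \<Longrightarrow> N (\<lambda>i. sigma_up r x i - real r powr q * x i) \<le> e"
    and e: "e \<ge> 0" and S: "1 \<le> (\<Sum>k<n. r k)" "(\<Sum>k<n. r k) \<le> R"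
  shows "\<bar>N (interleave n (\<lambda>k i. real (r k) powr q * x i)) - real (\<Sum>k<n. r k) powr q\<bar> \<le> real (n + 1) * e"
proof -
  define s where "s = (\<Sum>k<n. r k)"
  have xX: "x \<in> X" by (rule finite_support_mem[OF fin])
  \<comment> \<open>The value 0 of \<open>r k\<close> needs its own case: \<open>i div 0 = 0\<close>
    would make \<open>sigma_up 0 x\<close> the constant \<open>x 0\<close>, whereas the piece to be
    replaced vanishes, as \<open>0 powr q = 0\<close> for every \<open>q\<close>.\<close>
  define w where "w k = (if r k = 0 then (\<lambda>_. 0) else sigma_up (r k) x)" for k
  have wX: "w k \<in> X" for k unfolding w_def using zero_mem sigma_up_mem[OF xX] by auto
  let ?Z = "interleave n (\<lambda>k i. real (r k) powr q * x i)" and ?W = "interleave n w"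
  have ZX: "?Z \<in> X" and WX: "?W \<in> X"
    using interleave_mem_norm(1)[OF n] scale_mem[OF xX] wX by auto
  have sX: "sigma_up s x \<in> X" using sigma_up_mem[OF xX] S unfolding s_def by blast
  have WS: "N ?W = N (sigma_up s x)"
  proof (rule equidistributed(2)[OF sX])
    fix t :: real assume t: "t \<ge> 0"
    let ?D = "{j. t < \<bar>x j\<bar>}" and ?E = "\<lambda>k. {j. t < \<bar>w k j\<bar>}"
    have "?D \<subseteq> {..<L}" using fin t by (force simp: not_less[symmetric])
    then have finD: "finite ?D" by (rule finite_subset) simp
    have E: "finite (?E k) \<and> card (?E k) = r k * card ?D" for k
    proof (cases "r k = 0")
      case True
      then show ?thesis using t by (simp add: w_def)
    next
      case False
      then have "?E k \<approx> {..<r k} \<times> ?D" using sigma_up_level_set[of "r k" t x] by (simp add: w_def)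
      then show ?thesis using finD eqpoll_finite_iff[of "?E k" "{..<r k} \<times> ?D"]
        by (auto simp: eqpoll_iff_card card_cartesian_product)
    qed
    have "{i. t < \<bar>sigma_up s x i\<bar>} \<approx> {..<s} \<times> ?D" using S by (intro sigma_up_level_set) (simp add: s_def)
    also have "{..<s} \<times> ?D \<approx> Sigma {..<n} ?E"
      using finD E by (subst eqpoll_iff_card) (auto simp: s_def sum_distrib_right card_cartesian_product)
    also have "Sigma {..<n} ?E \<approx> {i. t < \<bar>?W i\<bar>}"
      by (rule eqpoll_sym[OF interleave_level_set[OF n]])
    finally show "{i. t < \<bar>sigma_up s x i\<bar>} \<approx> {i. t < \<bar>?W i\<bar>}" .
  qed
  have diff: "N (\<lambda>i. ?Z i - ?W i) \<le> real n * e"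
  proof -
    have "(\<lambda>i. ?Z i - ?W i) = interleave n (\<lambda>k i. real (r k) powr q * x i - w k i)"
      by (simp add: interleave_def)
    then have "N (\<lambda>i. ?Z i - ?W i) = N (interleave n (\<lambda>k i. real (r k) powr q * x i - w k i))" by simp
    also have "\<dots> \<le> (\<Sum>k<n. N (\<lambda>i. real (r k) powr q * x i - w k i))"
      by (rule interleave_mem_norm(2)[OF n diff_mem[OF scale_mem[OF xX] wX]])
    also have "\<dots> \<le> (\<Sum>k<n. e)"
    proof (rule sum_mono)
      fix k assume k: "k \<in> {..<n}"
      show "N (\<lambda>i. real (r k) powr q * x i - w k i) \<le> e"
      proof (cases "r k = 0")
        case False
        have "r k \<le> R" using member_le_sum[of k "{..<n}" r] k S by simp
        then show ?thesis
          using eig[of "r k"] False norm_diff_commute[OF scale_mem[OF xX] wX, of "real (r k) powr q" k]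
          by (simp add: w_def)
      qed (use e norm_zero in \<open>simp add: w_def\<close>)
    qed
    finally show ?thesis by simp
  qed
  have "N (\<lambda>i. sigma_up s x i - real s powr q * x i) \<le> e" using eig S unfolding s_def by blast
  moreover have "N (\<lambda>i. real s powr q * x i) = real s powr q" using norm_scale[OF xX] Nx by simp
  ultimately have "\<bar>N (sigma_up s x) - real s powr q\<bar> \<le> e"
    using norm_le_add_diff[OF sX scale_mem[OF xX], of "real s powr q"]
      norm_le_add_diff[OF scale_mem[OF xX] sX, of "real s powr q"]
      norm_diff_commute[OF sX scale_mem[OF xX], of "real s powr q"] by linarith
  moreover have "\<bar>N ?Z - N ?W\<bar> \<le> real n * e"
    using norm_le_add_diff[OF ZX WX] norm_le_add_diff[OF WX ZX] norm_diff_commute[OF ZX WX] diff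
    by linarith
  ultimately show ?thesis unfolding WS s_def[symmetric] by (simp add: algebra_simps)
qed

text \<open>Consecutive blocks of length \<open>L\<close> and interleaving are two arrangements of
  the same disjoint multiples of \<open>x\<close>: division by \<open>L\<close> and division by
  \<open>n\<close> match their level sets with the same disjoint union.\<close>

lemma norm_lin_comb_blocks:
  assumes fin: "\<And>i. i \<ge> L \<Longrightarrow> x i = 0" and L: "L \<ge> 1" and n: "n \<ge> 1"
  shows "N (lin_comb n a (block (\<lambda>k. k * L) (\<lambda>i. x (i mod L)))) = N (interleave n (\<lambda>k i. a k * x i))"
proof (rule equidistributed(2))
  let ?y = "lin_comb n a (block (\<lambda>k. k * L) (\<lambda>i. x (i mod L)))"
  have xX: "x \<in> X" by (rule finite_support_mem[OF fin])
  show "interleave n (\<lambda>k i. a k * x i) \<in> X" by (rule interleave_mem_norm(1)[OF n scale_mem[OF xX]])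
  fix t :: real assume t: "t \<ge> 0"
  have y: "?y i = (if i div L < n then a (i div L) * x (i mod L) else 0)" for i
  proof -
    have "(k * L \<le> i \<and> i < Suc k * L) = (k = i div L)" for k
    proof
      assume "k * L \<le> i \<and> i < Suc k * L"
      then show "k = i div L" using L by (metis div_nat_eqI mult.commute)
    next
      assume "k = i div L"
      then show "k * L \<le> i \<and> i < Suc k * L"
        using L dividend_less_div_times[of L i] by (auto simp: div_times_less_eq_dividend)
    qed
    then have "?y i = (\<Sum>k<n. if k = i div L then a k * x (i mod L) else 0)"
      unfolding lin_comb_def block_def by (intro sum.cong) auto
    then show ?thesis by (simp add: sum.delta)
  qed
  have "bij_betw (\<lambda>i. (i div L, i mod L)) {i. t < \<bar>?y i\<bar>} (Sigma {..<n} (\<lambda>k. {j. t < \<bar>a k * x j\<bar>}))"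
  proof (rule bij_betwI[where g = "\<lambda>(k, j). k * L + j"])
    have j: "j < L" if "t < \<bar>a k * x j\<bar>" for k j using that fin[of j] t by (cases "j < L") auto
    show "(\<lambda>(k, j). k * L + j) \<in> Sigma {..<n} (\<lambda>k. {j. t < \<bar>a k * x j\<bar>}) \<rightarrow> {i. t < \<bar>?y i\<bar>}"
      unfolding y using j L by fastforce
    show "(\<lambda>i. (i div L, i mod L)) ((\<lambda>(k, j). k * L + j) z) = z"
      if "z \<in> Sigma {..<n} (\<lambda>k. {j. t < \<bar>a k * x j\<bar>})" for z
      using that j L by (cases z) fastforce
  qed (use t in \<open>auto simp: y split: if_splits\<close>)
  then have "{i. t < \<bar>?y i\<bar>} \<approx> Sigma {..<n} (\<lambda>k. {j. t < \<bar>a k * x j\<bar>})"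
    unfolding eqpoll_def by blast
  then show "{i. t < \<bar>interleave n (\<lambda>k i. a k * x i) i\<bar>} \<approx> {i. t < \<bar>?y i\<bar>}"
    by (rule eqpoll_trans[OF interleave_level_set[OF n] eqpoll_sym])
qed

text \<open>Since \<open>real_of_ereal \<infinity> = 0\<close> and \<open>1 / 0 = 0\<close>, the reciprocal exponent of \<open>p = \<infinity>\<close> comes out as 0.\<close>

lemma interleave_lp_estimate:
  assumes p: "1 \<le> p" and q: "q = 1 / real_of_ereal p"
    and qmu: "fund_mu N \<le> q" "q \<le> fund_nu N" and n: "n \<ge> 1" and eps: "\<epsilon> > 0"
  obtains x L where "\<And>i. i \<ge> L \<Longrightarrow> x i = 0"
    "\<And>a. lp_norm p n a / (1 + \<epsilon>) \<le> N (interleave n (\<lambda>k i. a k * x i))"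
    "\<And>a. N (interleave n (\<lambda>k i. a k * x i)) \<le> (1 + \<epsilon>) * lp_norm p n a"
proof (cases "p = \<infinity>")
  case True
  then have q0: "q = 0" using q by simp
  then have q01: "0 \<le> q" "q \<le> 1" by simp_all
  obtain x L where fin: "\<And>i. i \<ge> L \<Longrightarrow> x i = 0" and Nx: "N x = 1"
    and eig: "\<And>r. 1 \<le> r \<Longrightarrow> r \<le> n \<Longrightarrow> N (\<lambda>i. sigma_up r x i - real r powr q * x i) \<le> \<epsilon>"
    by (rule approx_eigenvector[OF qmu q01 n eps], rule that)
  have xX: "x \<in> X" by (rule finite_support_mem[OF fin])
  have IX: "interleave n (\<lambda>k i. a k * x i) \<in> X" for a
    by (rule interleave_mem_norm(1)[OF n scale_mem[OF xX]])
  have lp: "lp_norm p n a = Max (insert 0 {\<bar>a k\<bar> |k. k < n})" for a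
    using True by (simp add: lp_norm_def)
  have fset: "finite (insert 0 {\<bar>a k\<bar> |k. k < n})" for a :: "nat \<Rightarrow> real" by simp
  have lp_ge: "\<bar>a k\<bar> \<le> lp_norm p n a" if "k < n" for a k
    unfolding lp by (rule Max_ge[OF fset]) (use that in auto)
  have lp0: "0 \<le> lp_norm p n a" for a unfolding lp by (rule Max_ge[OF fset]) simp
  have "N (sigma_up n x) \<le> N (\<lambda>i. 1 * x i) + N (\<lambda>i. sigma_up n x i - 1 * x i)"
    using norm_le_add_diff[OF sigma_up_mem[OF xX n] scale_mem[OF xX, of 1]] .
  also have "\<dots> \<le> 1 + \<epsilon>" using eig[of n] n Nx q0 by simp
  finally have sig: "N (sigma_up n x) \<le> 1 + \<epsilon>" .
  show ?thesis
  proof (rule that[OF fin])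
    fix a :: "nat \<Rightarrow> real"
    have "N (interleave n (\<lambda>k i. a k * x i)) \<le> N (\<lambda>i. lp_norm p n a * sigma_up n x i)"
    proof (rule dominated[OF scale_mem[OF sigma_up_mem[OF xX n]]])
      fix i
      have "\<bar>a (i mod n)\<bar> \<le> lp_norm p n a" using n by (intro lp_ge) simp
      then show "\<bar>interleave n (\<lambda>k i. a k * x i) i\<bar> \<le> \<bar>lp_norm p n a * sigma_up n x i\<bar>"
        using lp0[of a] by (simp add: interleave_def sigma_up_def abs_mult mult_right_mono)
    qed
    also have "\<dots> \<le> lp_norm p n a * (1 + \<epsilon>)"
      unfolding norm_scale[OF sigma_up_mem[OF xX n]] using lp0[of a] sig by (simp add: mult_left_mono)
    finally show "N (interleave n (\<lambda>k i. a k * x i)) \<le> (1 + \<epsilon>) * lp_norm p n a" by (simp add: mult.commute)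
    have "lp_norm p n a \<in> insert 0 {\<bar>a k\<bar> |k. k < n}" unfolding lp using fset by (intro Max_in) auto
    then have "lp_norm p n a \<le> N (interleave n (\<lambda>k i. a k * x i))"
    proof
      assume "lp_norm p n a = 0"
      then show ?thesis using norm_nonneg[OF IX] by simp
    next
      assume "lp_norm p n a \<in> {\<bar>a k\<bar> |k. k < n}"
      then obtain k where k: "k < n" "lp_norm p n a = \<bar>a k\<bar>" by blast
      have "(\<lambda>i. interleave n (\<lambda>k i. a k * x i) (i * n + k)) = (\<lambda>i. a k * x i)"
        using k by (simp add: interleave_def)
      moreover have "inj (\<lambda>i. i * n + k)" using n by (auto simp: inj_on_def)
      ultimately have "N (\<lambda>i. a k * x i) \<le> N (interleave n (\<lambda>k i. a k * x i))"
        using reindexed(2)[OF IX] by metis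
      then show ?thesis using norm_scale[OF xX] Nx k by simp
    qed
    moreover have "lp_norm p n a / (1 + \<epsilon>) \<le> lp_norm p n a"
      using lp0[of a] eps by (simp add: divide_le_eq mult_le_cancel_left1)
    ultimately show "lp_norm p n a / (1 + \<epsilon>) \<le> N (interleave n (\<lambda>k i. a k * x i))" by simp
  qed
next
  case False
  define p' where "p' = real_of_ereal p"
  have p': "p' \<ge> 1" and qp: "q = 1 / p'" using p False q unfolding p'_def by (cases p; simp)+
  have q01: "0 < q" "q \<le> 1" using p' qp by auto
  \<comment> \<open>In these quotients \<open>n\<close> is the total loss from rounding
    \<open>n\<close> weights to multiples of \<open>1 / M\<close>, and 1 is the additive error left
    by the choice \<open>e = 1 / (n + 1)\<close>. Both become negligible against
    \<open>M powr q\<close> because \<open>q > 0\<close>, which is why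
    \<open>p = \<infinity>\<close> is separate.\<close>
  have "(\<lambda>M. ((real M + real n) powr q + 1) / real M powr q) \<longlonglongrightarrow> 1" using q01 by real_asymp
  then have ev1: "eventually (\<lambda>M. ((real M + real n) powr q + 1) / real M powr q < 1 + \<epsilon>) sequentially"
    using eps by (intro order_tendstoD(2)) auto
  have "(\<lambda>M. ((real M - real n) powr q - 1) / real M powr q) \<longlonglongrightarrow> 1" using q01 by real_asymp
  then have ev2: "eventually (\<lambda>M. ((real M - real n) powr q - 1) / real M powr q > 1 / (1 + \<epsilon>)) sequentially"
    using eps by (intro order_tendstoD(1)) auto
  have "eventually (\<lambda>M. ((real M + real n) powr q + 1) / real M powr q < 1 + \<epsilon>
      \<and> ((real M - real n) powr q - 1) / real M powr q > 1 / (1 + \<epsilon>) \<and> M > n) sequentially"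
    using ev1 ev2 eventually_gt_at_top[of n] by eventually_elim auto
  then obtain M where M: "((real M + real n) powr q + 1) / real M powr q < 1 + \<epsilon>"
    "((real M - real n) powr q - 1) / real M powr q > 1 / (1 + \<epsilon>)" "M > n"
    using eventually_happens'[OF sequentially_bot] by blast
  define e where "e = 1 / real (n + 1)"
  have e: "e > 0" "real (n + 1) * e = 1" unfolding e_def by auto
  obtain x L where fin: "\<And>i. i \<ge> L \<Longrightarrow> x i = 0" and Nx: "N x = 1"
    and eig: "\<And>r. 1 \<le> r \<Longrightarrow> r \<le> M + n \<Longrightarrow> N (\<lambda>i. sigma_up r x i - real r powr q * x i) \<le> e"
  proof (rule approx_eigenvector[OF qmu])
    show "0 \<le> q" "q \<le> 1" "1 \<le> M + n" "0 < e" using q01 n e by auto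
  qed (rule that)
  have xX: "x \<in> X" by (rule finite_support_mem[OF fin])
  have IX: "interleave n (\<lambda>k i. a k * x i) \<in> X" for a
    by (rule interleave_mem_norm(1)[OF n scale_mem[OF xX]])
  have cmp: "N (interleave n (\<lambda>k i. a k * x i)) \<le> c * N (interleave n (\<lambda>k i. b k * x i))"
    if "c \<ge> 0" "\<And>k. k < n \<Longrightarrow> \<bar>a k\<bar> \<le> c * \<bar>b k\<bar>" for a b c
  proof -
    have "N (interleave n (\<lambda>k i. a k * x i)) \<le> N (\<lambda>i. c * interleave n (\<lambda>k i. b k * x i) i)"
    proof (rule dominated[OF scale_mem[OF IX]])
      fix i
      have "\<bar>a (i mod n)\<bar> \<le> c * \<bar>b (i mod n)\<bar>" using n by (intro that) simp
      then show "\<bar>interleave n (\<lambda>k i. a k * x i) i\<bar> \<le> \<bar>c * interleave n (\<lambda>k i. b k * x i) i\<bar>"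
        using that(1) by (simp add: interleave_def abs_mult mult.assoc[symmetric] mult_right_mono)
    qed
    then show ?thesis using norm_scale[OF IX] that(1) by simp
  qed
  have est: "N (interleave n (\<lambda>k i. real (r k) powr q * x i)) \<le> real (\<Sum>k<n. r k) powr q + 1"
    "real (\<Sum>k<n. r k) powr q - 1 \<le> N (interleave n (\<lambda>k i. real (r k) powr q * x i))"
    if "1 \<le> (\<Sum>k<n. r k)" "(\<Sum>k<n. r k) \<le> M + n" for r
    using norm_interleave_powr[where L = L and x = x, OF fin Nx n eig less_imp_le[OF e(1)] that] e(2) by linarith+
  show ?thesis
  proof (rule that[OF fin])
    fix a :: "nat \<Rightarrow> real"
    define s where "s = lp_norm p n a"
    have s: "s = (\<Sum>k<n. \<bar>a k\<bar> powr p') powr q"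
      unfolding s_def lp_norm_def qp p'_def using False by simp
    have s0: "s \<ge> 0" unfolding s by simp
    have "s / (1 + \<epsilon>) \<le> N (interleave n (\<lambda>k i. a k * x i)) \<and> N (interleave n (\<lambda>k i. a k * x i)) \<le> (1 + \<epsilon>) * s"
    proof (cases "s = 0")
      case True
      then have "(\<Sum>k<n. \<bar>a k\<bar> powr p') = 0" unfolding s by simp
      then have "a k = 0" if "k < n" for k using that by (subst (asm) sum_nonneg_eq_0_iff) auto
      then have "interleave n (\<lambda>k i. a k * x i) = (\<lambda>_. 0)" using n by (simp add: interleave_def fun_eq_iff)
      then show ?thesis using True norm_zero by simp
    next
      case False
      then have spos: "s > 0" using s0 by simp
      define T where "T = (\<Sum>k<n. \<bar>a k\<bar> powr p')"
      have T: "T > 0" using False sum_nonneg[of "{..<n}" "\<lambda>k. \<bar>a k\<bar> powr p'"] unfolding s T_def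
        by (cases "(\<Sum>k<n. \<bar>a k\<bar> powr p') = 0") auto
      define w where "w k = \<bar>a k\<bar> powr p' / T" for k
      have w0: "w k \<ge> 0" for k unfolding w_def using T by simp
      have w1: "(\<Sum>k<n. w k) = 1" unfolding w_def using T by (simp add: sum_divide_distrib[symmetric] T_def)
      have wa: "\<bar>a k\<bar> = s * w k powr q" for k
        unfolding w_def s T_def[symmetric] using T p' qp by (simp add: powr_divide powr_powr)
      \<comment> \<open>\<open>r k\<close> and \<open>Suc (r k)\<close> enclose
        \<open>M * w k\<close>; the first serves the lower and the second the upper estimate,
        through the domination in \<open>cmp\<close>. \<open>M > n\<close> keeps the sum of the
        \<open>r k\<close> at least 1, as \<open>est\<close> requires.\<close>
      define r where "r k = nat \<lfloor>real M * w k\<rfloor>" for k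
      have rk: "real (r k) \<le> real M * w k" "real M * w k \<le> real (Suc (r k))" for k
        unfolding r_def using w0[of k] by (auto simp: of_nat_nat intro: less_imp_le) linarith
      have "real (\<Sum>k<n. r k) \<le> (\<Sum>k<n. real M * w k)" unfolding of_nat_sum by (intro sum_mono rk)
      also have "\<dots> = real M" by (simp add: sum_distrib_left[symmetric] w1)
      finally have r_up: "(\<Sum>k<n. r k) \<le> M" by (simp only: of_nat_le_iff)
      have "real M = (\<Sum>k<n. real M * w k)" by (simp add: sum_distrib_left[symmetric] w1)
      also have "\<dots> \<le> (\<Sum>k<n. real (Suc (r k)))" by (intro sum_mono rk)
      finally have "real M \<le> real (\<Sum>k<n. Suc (r k))" by simp
      then have r_low: "M \<le> (\<Sum>k<n. Suc (r k))" by linarith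
      have r_suc: "(\<Sum>k<n. Suc (r k)) = (\<Sum>k<n. r k) + n" by (simp add: sum.distrib[of r "\<lambda>_. 1", simplified])
      define c where "c = s / real M powr q"
      have Mq: "real M powr q > 0" using M by simp
      have c: "c > 0" unfolding c_def using spos Mq by simp
      have ca: "\<bar>a k\<bar> = c * (real M * w k) powr q" for k
        unfolding wa c_def using Mq w0 by (simp add: powr_mult)
      have "N (interleave n (\<lambda>k i. a k * x i)) \<le> c * N (interleave n (\<lambda>k i. real (Suc (r k)) powr q * x i))"
        using c q01 rk w0 by (intro cmp) (auto simp: ca intro!: mult_left_mono powr_mono2 simp del: of_nat_Suc)
      also have "\<dots> \<le> c * (real (\<Sum>k<n. Suc (r k)) powr q + 1)"
        using c r_up r_low r_suc M n by (intro mult_left_mono est) auto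
      also have "\<dots> \<le> c * ((real M + real n) powr q + 1)"
      proof -
        have "real (\<Sum>k<n. Suc (r k)) \<le> real M + real n" using of_nat_mono[OF r_up, where 'a = real] unfolding r_suc of_nat_add by linarith
        then show ?thesis using c q01 by (intro mult_left_mono add_right_mono powr_mono2 of_nat_0_le_iff) auto
      qed
      also have "\<dots> = s * (((real M + real n) powr q + 1) / real M powr q)" unfolding c_def by simp
      also have "\<dots> \<le> s * (1 + \<epsilon>)" using M(1) spos by (intro mult_left_mono) auto
      finally have up: "N (interleave n (\<lambda>k i. a k * x i)) \<le> (1 + \<epsilon>) * s" by (simp add: mult.commute)
      have "s / (1 + \<epsilon>) = s * (1 / (1 + \<epsilon>))" by simp
      also have "\<dots> \<le> s * (((real M - real n) powr q - 1) / real M powr q)"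
        using M(2) spos by (intro mult_left_mono) auto
      also have "\<dots> = c * ((real M - real n) powr q - 1)" unfolding c_def by simp
      also have "\<dots> \<le> c * (real (\<Sum>k<n. r k) powr q - 1)"
      proof -
        have "real M - real n \<le> real (\<Sum>k<n. r k)" using r_low unfolding r_suc by linarith
        then show ?thesis using c q01 M by (intro mult_left_mono diff_right_mono powr_mono2) auto
      qed
      also have "\<dots> \<le> c * N (interleave n (\<lambda>k i. real (r k) powr q * x i))"
        using c r_up r_low r_suc M by (intro mult_left_mono est) auto
      also have "\<dots> \<le> N (interleave n (\<lambda>k i. a k * x i))"
      proof -
        have "N (interleave n (\<lambda>k i. real (r k) powr q * x i)) \<le> (1 / c) * N (interleave n (\<lambda>k i. a k * x i))"
          using c q01 rk by (intro cmp) (auto simp: ca intro!: powr_mono2)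
        then show ?thesis using c by (simp add: field_simps)
      qed
      finally show ?thesis using up by simp
    qed
    then show "lp_norm p n a / (1 + \<epsilon>) \<le> N (interleave n (\<lambda>k i. a k * x i))"
      "N (interleave n (\<lambda>k i. a k * x i)) \<le> (1 + \<epsilon>) * lp_norm p n a" unfolding s_def by auto
  qed
qed

lemma sym_block_fin_rep_if:
  assumes p: "1 \<le> p" and q: "fund_mu N \<le> 1 / real_of_ereal p" "1 / real_of_ereal p \<le> fund_nu N"
  shows "sym_block_fin_rep X N p"
  unfolding sym_block_fin_rep_def
proof (intro allI impI)
  fix n :: nat and \<epsilon> :: real
  assume n: "n \<ge> 1" and eps: "\<epsilon> > 0"
  obtain x L0 where fin0: "\<And>i. i \<ge> L0 \<Longrightarrow> x i = 0"
    and est: "\<And>a. lp_norm p n a / (1 + \<epsilon>) \<le> N (interleave n (\<lambda>k i. a k * x i))"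
      "\<And>a. N (interleave n (\<lambda>k i. a k * x i)) \<le> (1 + \<epsilon>) * lp_norm p n a"
    using interleave_lp_estimate[OF p refl q n eps] by metis
  \<comment> \<open>The successor excludes empty blocks, since the end points must increase
    strictly.\<close>
  define L where "L = Suc L0"
  have fin: "x i = 0" if "i \<ge> L" for i using fin0 that unfolding L_def by simp
  have L: "L \<ge> 1" unfolding L_def by simp
  let ?m = "\<lambda>k. k * L" and ?c = "\<lambda>i. x (i mod L)"
  have coeffs: "block_coeffs ?m ?c k = map x [0..<L]" for k
    unfolding block_coeffs_def by (rule nth_equalityI) auto
  show "\<exists>m c. m 0 = 0 \<and> (\<forall>k<n. m k < m (Suc k))
      \<and> (\<forall>j<n. \<forall>k<n. mset (block_coeffs m c j) = mset (block_coeffs m c k))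
      \<and> (\<forall>a. lp_norm p n a / (1 + \<epsilon>) \<le> N (lin_comb n a (block m c))
             \<and> N (lin_comb n a (block m c)) \<le> (1 + \<epsilon>) * lp_norm p n a)"
    using L est norm_lin_comb_blocks[of L x, OF fin L n]
    by (intro exI[of _ ?m] exI[of _ ?c]) (simp add: coeffs)
qed

section \<open>From blocks to disjoint copies, and necessity of the index bounds\<close>

lemma block_mem: "block m c k \<in> X"
  by (rule finite_support_mem[of "m (Suc k)"]) (simp add: block_def)

lemma sym_block_fin_rep_imp_sym_fin_rep:
  assumes "sym_block_fin_rep X N p"
  shows "sym_fin_rep X N p"
  unfolding sym_fin_rep_def
proof (intro allI impI)
  fix n :: nat and \<epsilon> :: real
  assume n: "n \<ge> 1" and eps: "\<epsilon> > 0"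
  obtain m c where m: "\<forall>k<n. m k < m (Suc k)"
    and eq: "\<forall>j<n. \<forall>k<n. mset (block_coeffs m c j) = mset (block_coeffs m c k)"
    and est: "\<forall>a. lp_norm p n a / (1 + \<epsilon>) \<le> N (lin_comb n a (block m c))
             \<and> N (lin_comb n a (block m c)) \<le> (1 + \<epsilon>) * lp_norm p n a"
    using assms[unfolded sym_block_fin_rep_def, rule_format, OF n eps] by (elim exE conjE) (rule that)
  have mono: "m (Suc j) \<le> m k" if "j < k" "k \<le> n" for j k
    using that
  proof (induction k)
    case (Suc k)
    then show ?case using m[rule_format, of k] by (cases "j = k") auto
  qed simp
  have disj: "block m c j i = 0 \<or> block m c k i = 0" if "j < n" "k < n" "j \<noteq> k" for j k i
    using mono[of j k] mono[of k j] that by (cases "j < k") (auto simp: block_def)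
  show "\<exists>x. (\<forall>k<n. x k \<in> X) \<and> (\<forall>j<n. \<forall>k<n. j \<noteq> k \<longrightarrow> (\<forall>i. x j i = 0 \<or> x k i = 0))
      \<and> (\<forall>j<n. \<forall>k<n. same_ord_dist (x j) (x k))
      \<and> (\<forall>a. lp_norm p n a / (1 + \<epsilon>) \<le> N (lin_comb n a x)
             \<and> N (lin_comb n a x) \<le> (1 + \<epsilon>) * lp_norm p n a)"
  proof (intro exI[of _ "block m c"] conjI allI impI)
    fix j k assume jk: "j < n" "k < n"
    show "same_ord_dist (block m c j) (block m c k)"
      by (rule same_ord_dist_blocks[OF _ _ eq[rule_format, OF jk]])
        (use m jk in \<open>simp_all add: less_imp_le\<close>)
    show "block m c j i = 0 \<or> block m c k i = 0" if "j \<noteq> k" for i by (rule disj[OF jk that])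
  next
    fix a
    show "lp_norm p n a / (1 + \<epsilon>) \<le> N (lin_comb n a (block m c))"
      "N (lin_comb n a (block m c)) \<le> (1 + \<epsilon>) * lp_norm p n a"
      using est by simp_all
  qed (rule block_mem)
qed

lemma sym_fin_rep_imp_crude:
  assumes "sym_fin_rep X N p"
  shows "crude_sym_fin_rep X N p"
  unfolding crude_sym_fin_rep_def
proof (intro exI[of _ 2] conjI allI impI)
  fix n :: nat assume "n \<ge> 1"
  then show "\<exists>x. (\<forall>k<n. x k \<in> X) \<and> (\<forall>j<n. \<forall>k<n. j \<noteq> k \<longrightarrow> (\<forall>i. x j i = 0 \<or> x k i = 0))
      \<and> (\<forall>j<n. \<forall>k<n. same_ord_dist (x j) (x k))
      \<and> (\<forall>a. lp_norm p n a / 2 \<le> N (lin_comb n a x) \<and> N (lin_comb n a x) \<le> 2 * lp_norm p n a)"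
    using assms[unfolded sym_fin_rep_def, rule_format, of n 1] by (simp only: one_add_one zero_less_one)
qed simp

text \<open>The supports may lie anywhere and be infinite. Disjointness makes the level set of the
  sum the disjoint union of those of the summands, and each of these is a bijective image of the
  level set of \<open>x 0\<close>.\<close>

lemma norm_sum_disjoint_copies:
  assumes n: "n \<ge> 1" and x: "\<And>k. k < n \<Longrightarrow> x k \<in> X"
    and disj: "\<And>j k i. j < n \<Longrightarrow> k < n \<Longrightarrow> j \<noteq> k \<Longrightarrow> x j i = 0 \<or> x k i = 0"
    and copies: "\<And>k. k < n \<Longrightarrow> same_ord_dist (x 0) (x k)"
  shows "N (lin_comb n (\<lambda>_. 1) x) = N (sigma_up n (x 0))"
proof (rule equidistributed(2))
  show "sigma_up n (x 0) \<in> X" using n x by (intro sigma_up_mem) auto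
  fix t :: real assume t: "t \<ge> 0"
  let ?D = "\<lambda>k. {i. t < \<bar>x k i\<bar>}"
  have D: "?D 0 \<approx> ?D k" if k: "k < n" for k
  proof -
    obtain \<pi> where \<pi>: "bij \<pi>" "\<And>i. x k (\<pi> i) = x 0 i" using copies[OF k] unfolding same_ord_dist_def by blast
    have image: "?D k = \<pi> ` ?D 0"
    proof (intro equalityI subsetI)
      fix i assume "i \<in> ?D k"
      moreover obtain j where "i = \<pi> j" using \<pi>(1) by (metis bij_pointE)
      ultimately show "i \<in> \<pi> ` ?D 0" using \<pi>(2) by auto
    qed (use \<pi>(2) in auto)
    have "inj_on \<pi> (?D 0)" using bij_is_inj[OF \<pi>(1)] by (rule inj_on_subset) simp
    then show ?thesis unfolding image by (rule eqpoll_sym[OF inj_on_image_eqpoll_self])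
  qed
  have lin_comb_eq: "lin_comb n (\<lambda>_. 1) x i = x k i" if "k < n" "x k i \<noteq> 0" for i k
  proof -
    have "(\<Sum>j<n. x j i) = (\<Sum>j<n. if j = k then x k i else 0)"
    proof (intro sum.cong refl)
      fix j assume "j \<in> {..<n}"
      then show "x j i = (if j = k then x k i else 0)" using disj[of j k i] that by auto
    qed
    then show ?thesis using that(1) by (simp add: lin_comb_def)
  qed
  have "bij_betw snd (Sigma {..<n} ?D) {i. t < \<bar>lin_comb n (\<lambda>_. 1) x i\<bar>}"
    unfolding bij_betw_def
  proof
    show "inj_on snd (Sigma {..<n} ?D)"
    proof (rule inj_onI)
      fix z z' assume z: "z \<in> Sigma {..<n} ?D" "z' \<in> Sigma {..<n} ?D" "snd z = snd z'"
      then have "x (fst z) (snd z) \<noteq> 0" "x (fst z') (snd z) \<noteq> 0" "fst z < n" "fst z' < n"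
        using t by auto
      then have "fst z = fst z'" using disj[of "fst z" "fst z'" "snd z"] by blast
      then show "z = z'" using z(3) by (rule prod_eqI)
    qed
    show "snd ` Sigma {..<n} ?D = {i. t < \<bar>lin_comb n (\<lambda>_. 1) x i\<bar>}"
    proof (intro equalityI subsetI)
      fix i assume "i \<in> snd ` Sigma {..<n} ?D"
      then obtain k where "k < n" "t < \<bar>x k i\<bar>" by auto
      moreover from this have "x k i \<noteq> 0" using t by auto
      ultimately show "i \<in> {i. t < \<bar>lin_comb n (\<lambda>_. 1) x i\<bar>}" using lin_comb_eq by simp
    next
      fix i assume i: "i \<in> {i. t < \<bar>lin_comb n (\<lambda>_. 1) x i\<bar>}"
      then have "(\<Sum>j<n. x j i) \<noteq> 0" using t by (auto simp: lin_comb_def)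
      then obtain k where "k < n" "x k i \<noteq> 0" by (metis lessThan_iff sum.neutral)
      then show "i \<in> snd ` Sigma {..<n} ?D" using lin_comb_eq[of k i] i by (intro image_eqI[of _ _ "(k, i)"]) auto
    qed
  qed
  then have sum: "Sigma {..<n} ?D \<approx> {i. t < \<bar>lin_comb n (\<lambda>_. 1) x i\<bar>}" unfolding eqpoll_def by blast
  have "{..<n} \<times> ?D 0 \<approx> Sigma {..<n} ?D"
    by (rule Sigma_eqpoll_cong[OF bij_betw_id]) (simp only: id_apply lessThan_iff D)
  from eqpoll_trans[OF eqpoll_trans[OF sigma_up_level_set[OF n] this] sum]
  show "{i. t < \<bar>sigma_up n (x 0) i\<bar>} \<approx> {i. t < \<bar>lin_comb n (\<lambda>_. 1) x i\<bar>}" .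
qed

lemma crude_sym_fin_rep_bounds:
  assumes crude: "crude_sym_fin_rep X N p"
  shows "boyd_alpha X N \<le> 1 / real_of_ereal p" "1 / real_of_ereal p \<le> boyd_beta X N"
proof -
  define q where "q = 1 / real_of_ereal p"
  obtain C where C: "C > 0" and rep: "\<forall>n\<ge>1. \<exists>x. (\<forall>k<n. x k \<in> X)
      \<and> (\<forall>j<n. \<forall>k<n. j \<noteq> k \<longrightarrow> (\<forall>i. x j i = 0 \<or> x k i = 0))
      \<and> (\<forall>j<n. \<forall>k<n. same_ord_dist (x j) (x k))
      \<and> (\<forall>a. lp_norm p n a / C \<le> N (lin_comb n a x) \<and> N (lin_comb n a x) \<le> C * lp_norm p n a)"
    using crude unfolding crude_sym_fin_rep_def by (elim exE conjE) (rule that)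
  \<comment> \<open>Two coefficient vectors are tested: the first unit vector, which controls
    \<open>N (x 0)\<close>, and the all-ones vector, which controls
    \<open>N (sigma_up n (x 0))\<close>. Each costs a factor \<open>C\<close>.\<close>
  have key: "real n powr q \<le> C ^ 2 * op_norm X N (sigma_up n)"
    "1 \<le> C ^ 2 * op_norm X N (sigma_down n) * real n powr q" if n: "n \<ge> 1" for n
  proof -
    obtain x where x: "\<forall>k<n. x k \<in> X"
      and disj: "\<forall>j<n. \<forall>k<n. j \<noteq> k \<longrightarrow> (\<forall>i. x j i = 0 \<or> x k i = 0)"
      and copies: "\<forall>j<n. \<forall>k<n. same_ord_dist (x j) (x k)"
      and est: "\<forall>a. lp_norm p n a / C \<le> N (lin_comb n a x) \<and> N (lin_comb n a x) \<le> C * lp_norm p n a"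
      using rep[rule_format, OF n] by (elim exE conjE) (rule that)
    have x0: "x 0 \<in> X" using x n by simp
    have "lin_comb n (unitvec 0) x i = x 0 i" for i
    proof -
      have "lin_comb n (unitvec 0) x i = (\<Sum>k<n. if k = 0 then x 0 i else 0)"
        unfolding lin_comb_def by (intro sum.cong) (auto simp: unitvec_def)
      then show ?thesis using n by (simp add: sum.delta)
    qed
    then have lc: "lin_comb n (unitvec 0) x = x 0" by blast
    have N0: "1 / C \<le> N (x 0)" "N (x 0) \<le> C"
      using est[rule_format, of "unitvec 0"] unfolding lc lp_norm_unitvec[OF n] by simp_all
    have NS: "real n powr q / C \<le> N (sigma_up n (x 0))" "N (sigma_up n (x 0)) \<le> C * real n powr q"
      using est[rule_format, of "\<lambda>_. 1"] norm_sum_disjoint_copies[OF n, of x] x disj copies n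
      unfolding lp_norm_ones[OF n] q_def[symmetric] by simp_all
    have "real n powr q / C \<le> op_norm X N (sigma_up n) * N (x 0)"
      using NS(1) sigma_up_op_norm[OF x0 n] by linarith
    also have "\<dots> \<le> op_norm X N (sigma_up n) * C"
      using N0 op_norm_sigma_up_ge_1[OF n] by (intro mult_left_mono) auto
    finally show "real n powr q \<le> C ^ 2 * op_norm X N (sigma_up n)"
      using C by (simp add: divide_le_eq power2_eq_square mult_ac)
    have down: "sigma_down n (sigma_up n (x 0)) = x 0"
    proof
      fix i
      have "(\<Sum>k\<in>{i * n..<i * n + n}. x 0 (k div n)) = (\<Sum>k\<in>{i * n..<i * n + n}. x 0 i)"
        by (intro sum.cong refl arg_cong[where f = "x 0"] div_nat_eqI) (auto simp: mult.commute)
      then show "sigma_down n (sigma_up n (x 0)) i = x 0 i"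
        using n by (simp add: sigma_down_def sigma_up_def)
    qed
    have pos: "op_norm X N (sigma_down n) \<ge> 0"
      using op_norm_sigma_down_ge[OF n] by (rule order_trans[rotated]) simp
    have "1 / C \<le> op_norm X N (sigma_down n) * N (sigma_up n (x 0))"
      using N0(1) sigma_down_op_norm[OF sigma_up_mem[OF x0 n] n] unfolding down by linarith
    also have "\<dots> \<le> op_norm X N (sigma_down n) * (C * real n powr q)"
      using NS(2) pos by (rule mult_left_mono)
    finally show "1 \<le> C ^ 2 * op_norm X N (sigma_down n) * real n powr q"
      using C by (simp add: divide_le_eq power2_eq_square mult_ac)
  qed
  \<comment> \<open>After division by \<open>log 2 n\<close> the constant \<open>C ^ 2\<close>
    disappears in the limit, which is why a crude representation is as good as an almost isometric
    one.\<close>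
  have lim: "(\<lambda>n. c - log 2 (C ^ 2) / log 2 (real n)) \<longlonglongrightarrow> c" for c by real_asymp
  have up: "q - log 2 (C ^ 2) / log 2 (real n) \<le> log 2 (op_norm X N (sigma_up n)) / log 2 (real n)"
    and down: "- q - log 2 (C ^ 2) / log 2 (real n) \<le> log 2 (op_norm X N (sigma_down n)) / log 2 (real n)"
    if n: "n \<ge> 2" for n
  proof -
    have n1: "n \<ge> 1" using n by simp
    have ln: "log 2 (real n) > 0" using n by simp
    have pos: "op_norm X N (sigma_up n) > 0" "op_norm X N (sigma_down n) > 0"
      using op_norm_sigma_up_ge_1[OF n1] op_norm_sigma_down_ge[OF n1] n1
      by (auto intro: less_le_trans[rotated])
    have "log 2 (real n powr q) \<le> log 2 (C ^ 2 * op_norm X N (sigma_up n))"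
      using key(1)[OF n1] n by (intro log_mono) auto
    then have "q * log 2 (real n) \<le> log 2 (C ^ 2) + log 2 (op_norm X N (sigma_up n))"
      using pos C n by (simp add: log_powr log_mult)
    then have "q \<le> (log 2 (C ^ 2) + log 2 (op_norm X N (sigma_up n))) / log 2 (real n)"
      using ln by (simp add: pos_le_divide_eq)
    then show "q - log 2 (C ^ 2) / log 2 (real n) \<le> log 2 (op_norm X N (sigma_up n)) / log 2 (real n)"
      by (simp add: add_divide_distrib)
    have "log 2 1 \<le> log 2 (C ^ 2 * op_norm X N (sigma_down n) * real n powr q)"
      using key(2)[OF n1] by (intro log_mono) auto
    then have "0 \<le> log 2 (C ^ 2) + log 2 (op_norm X N (sigma_down n)) + q * log 2 (real n)"
      using pos C n by (simp add: log_powr log_mult)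
    then have "- q \<le> (log 2 (C ^ 2) + log 2 (op_norm X N (sigma_down n))) / log 2 (real n)"
      using ln by (simp add: pos_le_divide_eq)
    then show "- q - log 2 (C ^ 2) / log 2 (real n) \<le> log 2 (op_norm X N (sigma_down n)) / log 2 (real n)"
      by (simp add: add_divide_distrib)
  qed
  show "1 / real_of_ereal p \<le> boyd_beta X N"
    unfolding q_def[symmetric] by (rule LIMSEQ_le[OF lim boyd_beta_limit]) (use up in blast)
  have "- q \<le> - boyd_alpha X N"
    by (rule LIMSEQ_le[OF lim boyd_alpha_limit]) (use down in blast)
  then show "boyd_alpha X N \<le> 1 / real_of_ereal p" unfolding q_def[symmetric] by simp
qed

end

text \<open>The conventions agree at the ends: \<open>einv 0 = \<infinity>\<close> corresponds to
  \<open>1 / real_of_ereal \<infinity> = 0\<close>, so inequalities between exponents become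
  reversed inequalities between reciprocals without exceptions.\<close>

lemma einv_le_iff:
  assumes "1 \<le> p" "0 \<le> t"
  shows "einv t \<le> p \<longleftrightarrow> 1 / real_of_ereal p \<le> t" "p \<le> einv t \<longleftrightarrow> t \<le> 1 / real_of_ereal p"
  using assms by (cases p; auto simp: einv_def field_simps)+

theorem theorem5p3:
  fixes X :: "(nat \<Rightarrow> real) set" and N :: "(nat \<Rightarrow> real) \<Rightarrow> real" and p :: ereal
  assumes "symmetric_seq_space X N"
    and "X \<noteq> {\<lambda>_. 0}"
    and "separable_space X N"
    and "fundamental_type X N"
    and "1 \<le> p"
  shows "(sym_block_fin_rep X N p \<longleftrightarrow> sym_fin_rep X N p)
       \<and> (sym_fin_rep X N p \<longleftrightarrow> crude_sym_fin_rep X N p)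
       \<and> (crude_sym_fin_rep X N p \<longleftrightarrow>
            (einv (boyd_beta X N) \<le> p \<and> p \<le> einv (boyd_alpha X N)))"
proof -
  interpret symmetric_space X N using assms by unfold_locales
  have "crude_sym_fin_rep X N p \<Longrightarrow> einv (boyd_beta X N) \<le> p \<and> p \<le> einv (boyd_alpha X N)"
    using crude_sym_fin_rep_bounds einv_le_iff assms(5) boyd_alpha_nonneg boyd_beta_nonneg by blast
  \<comment> \<open>The construction starts from \<open>fund_mu\<close> and \<open>fund_nu\<close>,
    while the necessary condition concerns the Boyd indices; \<open>fundamental_type\<close>
    identifies the two intervals.\<close>
  moreover have "sym_block_fin_rep X N p" if "einv (boyd_beta X N) \<le> p \<and> p \<le> einv (boyd_alpha X N)"
    using that einv_le_iff[OF assms(5)] boyd_alpha_nonneg boyd_beta_nonneg assms(4)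
    by (intro sym_block_fin_rep_if[OF assms(5)]) (auto simp: fundamental_type_def)
  ultimately show ?thesis
    using sym_block_fin_rep_imp_sym_fin_rep sym_fin_rep_imp_crude by blast
qed

end
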